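(* Let $(\cdot)^{\dagger}$ denote either $(\cdot)^{H}$ or $(\cdot)^{T}$. Let $\mathcal{D}^{(1)},\dots,\mathcal{D}^{(L)}\in\mathbb{C}^{n_1\times n_2\times\cdots\times n_d}$ be diagonal tensors, $\alpha_1,\dots,\alpha_L\in\mathbb{R}^{+}$, $1\le r\le n_i$ and $Q_i\in\mathbb{C}^{n_i\times n_i}$ unitary for $1\le i\le d$, and let $$\mathcal{A}^{(\ell)}=\mathcal{D}^{(\ell)}\bullet_1(Q_1^{H})^{\dagger}\cdots\bullet_d(Q_d^{H})^{\dagger},\qquad 1\le\ell\le L.$$ Suppose that $$\sum_{\ell=1}^{L}\alpha_\ell|\mathcal{D}^{(\ell)}_{p\cdots p}|^2\ne0\qquad\text{for all }1\le p\le r.$$ Then $\omega_0=(Q_1I_{n_1\times r},\dots,Q_dI_{n_d\times r})$ is a scale semi-nondegenerate point of the function $$f(U^{(1)},\dots,U^{(d)})=\sum_{\ell=1}^{L}\alpha_\ell\|\mathrm{diag}\{\mathcal{W}^{(\ell)}\}\|^2,\qquad \mathcal{W}^{(\ell)}=\mathcal{A}^{(\ell)}\bullet_1(U^{(1)})^{\dagger}\cdots\bullet_d(U^{(d)})^{\dagger},\qquad U^{(i)}\in\mathrm{St}(r,n_i,\mathbb{C}).$$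
   Context: $d>1$; $\mathrm{St}(r,n,\mathbb{C})=\{X\in\mathbb{C}^{n\times r}:X^{H}X=I_r\}$; $X^T$, $X^H$ are transpose and conjugate transpose; $\mathbb{R}^{+}=[0,\infty)$. $I_{n\times r}$ is the $n\times r$ matrix with ones on the diagonal and zeros elsewhere. Mode product: for $\mathcal{A}\in\mathbb{C}^{n_1\times\cdots\times n_d}$ and $X\in\mathbb{C}^{m\times n_i}$, $(\mathcal{A}\bullet_iX)_{p_1\cdots q\cdots p_d}=\sum_{p_i}\mathcal{A}_{p_1\cdots p_i\cdots p_d}X_{qp_i}$ ($q$ in position $i$). A tensor is diagonal if its only nonzero entries are among the diagonal entries $\mathcal{D}_{p\cdots p}$; $\mathrm{diag}\{\mathcal{W}\}=(\mathcal{W}_{1\cdots1},\dots,\mathcal{W}_{r\cdots r})^{T}$ for $\mathcal{W}\in\mathbb{C}^{r\times\cdots\times r}$. $\|\cdot\|$ is the Euclidean norm. $\mathrm{St}(r,n,\mathbb{C})$ is a Riemannian submanifold of $\mathbb{C}^{n\times r}$ with real inner product $\Re\,\mathrm{tr}(X^{H}Y)$. $h:\mathrm{St}(r,n,\mathbb{C})\to\mathbb{R}$ is scale invariant if $h(UR)=h(U)$ for all diagonal unitary $R\in\mathbb{C}^{r\times r}$; $U$ is a scale semi-nondegenerate point of $h$ if $h$ is scale invariant, the Riemannian gradient of $h$ vanishes at $U$, and the Riemannian Hessian $\mathrm{Hess}\,h(U)$ (a real-linear self-map of the tangent space) has real rank $2nr-r^2-r$. A point $\omega=(U^{(1)},\dots,U^{(d)})$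 is a scale semi-nondegenerate point of $f$ if, for every $i$, $U^{(i)}$ is a scale semi-nondegenerate point of the restricted function $h_{(i)}(U)=f(U^{(1)},\dots,U^{(i-1)},U,U^{(i+1)},\dots,U^{(d)})$ on $\mathrm{St}(r,n_i,\mathbb{C})$. *)

theory Defs
  imports Complex_Main "Jordan_Normal_Form.Schur_Decomposition"
begin

hide_const (open) Multiset.mult Polynomial.smult

section \<open>Stiefel manifolds and their Riemannian geometry\<close>

definition unitary_mat :: "nat \<Rightarrow> complex mat \<Rightarrow> bool" where
  "unitary_mat n Q \<longleftrightarrow> Q \<in> carrier_mat n n \<and> mat_adjoint Q * Q = 1\<^sub>m n \<and> Q * mat_adjoint Q = 1\<^sub>m n"

definition stiefel :: "nat \<Rightarrow> nat \<Rightarrow> complex mat set" where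
  "stiefel r n = {X \<in> carrier_mat n r. mat_adjoint X * X = 1\<^sub>m r}"

definition trunc_id :: "nat \<Rightarrow> nat \<Rightarrow> complex mat" where
  "trunc_id n r = mat n r (\<lambda>(i, j). if i = j then 1 else 0)"

definition mat_trace :: "complex mat \<Rightarrow> complex" where
  "mat_trace A = (\<Sum>i<dim_row A. A $$ (i, i))"

definition real_inner_mat :: "complex mat \<Rightarrow> complex mat \<Rightarrow> real" where
  "real_inner_mat X Y = Re (mat_trace (mat_adjoint X * Y))"

text \<open>Matrices of the type \<^typ>\<open>complex mat\<close> carry their size as a value, so the type is not a
  normed space. Derivatives of matrix-valued curves are therefore taken entry by entry.\<close>

definition has_mat_deriv ::
    "nat \<Rightarrow> nat \<Rightarrow> (real \<Rightarrow> complex mat) \<Rightarrow> complex mat \<Rightarrow> real \<Rightarrow> bool" where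
  "has_mat_deriv n r \<gamma> Z t \<longleftrightarrow> (\<forall>s. \<gamma> s \<in> carrier_mat n r) \<and> Z \<in> carrier_mat n r \<and>
     (\<forall>i<n. \<forall>j<r. ((\<lambda>s. \<gamma> s $$ (i, j)) has_vector_derivative Z $$ (i, j)) (at t))"

text \<open>A curve in the manifold through \<open>U\<close> at time \<open>0\<close> with velocity \<open>Z\<close>. Differentiability is
  required at time \<open>0\<close> only. Asking for curves defined on all of the real line is no restriction,
  because away from \<open>0\<close> the curve may be continued by the constant \<open>U\<close>.\<close>

definition stiefel_curve ::
    "nat \<Rightarrow> nat \<Rightarrow> (real \<Rightarrow> complex mat) \<Rightarrow> complex mat \<Rightarrow> complex mat \<Rightarrow> bool" where
  "stiefel_curve r n \<gamma> U Z \<longleftrightarrow> (\<forall>t. \<gamma> t \<in> stiefel r n) \<and> \<gamma> 0 = U \<and> has_mat_deriv n r \<gamma> Z 0"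

definition tangent_space :: "nat \<Rightarrow> nat \<Rightarrow> complex mat \<Rightarrow> complex mat set" where
  "tangent_space r n U = {Z. \<exists>\<gamma>. stiefel_curve r n \<gamma> U Z}"

text \<open>The tangent space as a vector space over the reals; the components \<open>mult\<close> and \<open>one\<close> of the
  record type play no role.\<close>

definition tangent_module :: "nat \<Rightarrow> nat \<Rightarrow> complex mat \<Rightarrow> (real, complex mat) module" where
  "tangent_module r n U = \<lparr>
     carrier = tangent_space r n U,
     mult = (*), one = 1\<^sub>m n,
     zero = 0\<^sub>m n r, add = (+),
     smult = (\<lambda>c X. complex_of_real c \<cdot>\<^sub>m X)\<rparr>"

text \<open>\<open>G\<close> is the tangent vector at \<open>U\<close> that represents the differential of \<open>h\<close>. Since all curves that
  are differentiable at \<open>0\<close> are tested, existence of \<open>G\<close> amounts to (Frechet) differentiability of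
  \<open>h\<close> at \<open>U\<close> on the manifold. Only the values of \<open>h\<close> on the manifold matter.\<close>

definition has_riem_grad ::
    "nat \<Rightarrow> nat \<Rightarrow> (complex mat \<Rightarrow> real) \<Rightarrow> complex mat \<Rightarrow> complex mat \<Rightarrow> bool" where
  "has_riem_grad r n h U G \<longleftrightarrow> G \<in> tangent_space r n U \<and>
     (\<forall>\<gamma> Z. stiefel_curve r n \<gamma> U Z \<longrightarrow>
        ((\<lambda>t. h (\<gamma> t)) has_real_derivative real_inner_mat G Z) (at 0))"

definition is_tangent_proj :: "nat \<Rightarrow> nat \<Rightarrow> complex mat \<Rightarrow> complex mat \<Rightarrow> complex mat \<Rightarrow> bool" where
  "is_tangent_proj r n U W V \<longleftrightarrow> V \<in> tangent_space r n U \<and>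
     (\<forall>Y \<in> tangent_space r n U. real_inner_mat V Y = real_inner_mat W Y)"

text \<open>The Riemannian Hessian sends \<open>Z\<close> to the covariant derivative of the gradient field along \<open>Z\<close>.
  For a Riemannian submanifold of a Euclidean space, the Levi-Civita derivative is the orthogonal
  projection onto the tangent space of the ambient derivative.\<close>

definition has_riem_hess ::
    "nat \<Rightarrow> nat \<Rightarrow> (complex mat \<Rightarrow> real) \<Rightarrow> complex mat \<Rightarrow> (complex mat \<Rightarrow> complex mat) \<Rightarrow> bool" where
  "has_riem_hess r n h U H \<longleftrightarrow>
     linear_map class_ring (tangent_module r n U) (tangent_module r n U) H \<and>
     (\<exists>grd. (\<forall>X \<in> stiefel r n. has_riem_grad r n h X (grd X)) \<and>
        (\<forall>\<gamma> Z. stiefel_curve r n \<gamma> U Z \<longrightarrow>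
           (\<exists>W. has_mat_deriv n r (\<lambda>t. grd (\<gamma> t)) W 0 \<and> is_tangent_proj r n U W (H Z))))"

definition real_rank :: "nat \<Rightarrow> nat \<Rightarrow> complex mat \<Rightarrow> (complex mat \<Rightarrow> complex mat) \<Rightarrow> nat" where
  "real_rank r n U H =
     vectorspace.dim class_ring ((tangent_module r n U)\<lparr>carrier := H ` tangent_space r n U\<rparr>)"

definition scale_invariant :: "nat \<Rightarrow> nat \<Rightarrow> (complex mat \<Rightarrow> real) \<Rightarrow> bool" where
  "scale_invariant r n h \<longleftrightarrow>
     (\<forall>U \<in> stiefel r n. \<forall>R. unitary_mat r R \<and> diagonal_mat R \<longrightarrow> h (U * R) = h U)"

definition scale_semi_nondegenerate ::
    "nat \<Rightarrow> nat \<Rightarrow> (complex mat \<Rightarrow> real) \<Rightarrow> complex mat \<Rightarrow> bool" where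
  "scale_semi_nondegenerate r n h U \<longleftrightarrow>
     U \<in> stiefel r n \<and> scale_invariant r n h \<and> has_riem_grad r n h U (0\<^sub>m n r) \<and>
     (\<exists>H. has_riem_hess r n h U H \<and>
        int (real_rank r n U H) = 2 * int n * int r - (int r)\<^sup>2 - int r)"

text \<open>A tuple of \<open>d\<close> matrices is a function on the naturals of which only the values at
  \<open>0, \<dots>, d - 1\<close> matter; modes and entries are numbered from \<open>0\<close>.\<close>

definition scale_semi_nondegenerate_tuple ::
    "nat \<Rightarrow> nat \<Rightarrow> (nat \<Rightarrow> nat) \<Rightarrow> ((nat \<Rightarrow> complex mat) \<Rightarrow> real) \<Rightarrow> (nat \<Rightarrow> complex mat) \<Rightarrow> bool" where
  "scale_semi_nondegenerate_tuple d r n f \<omega> \<longleftrightarrow>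
     (\<forall>i<d. scale_semi_nondegenerate r (n i) (\<lambda>U. f (\<omega>(i := U))) (\<omega> i))"

section \<open>Tensors\<close>

text \<open>A tensor of order \<open>d\<close> and size \<open>n 0 \<times> \<dots> \<times> n (d - 1)\<close> is a function on index lists, of which
  only the values on \<open>tensor_index d n\<close> matter.\<close>

type_synonym ctensor = "nat list \<Rightarrow> complex"

definition tensor_index :: "nat \<Rightarrow> (nat \<Rightarrow> nat) \<Rightarrow> nat list set" where
  "tensor_index d n = {p. length p = d \<and> (\<forall>i<d. p ! i < n i)}"

definition diagonal_tensor :: "nat \<Rightarrow> (nat \<Rightarrow> nat) \<Rightarrow> ctensor \<Rightarrow> bool" where
  "diagonal_tensor d n D \<longleftrightarrow> (\<forall>p \<in> tensor_index d n. D p \<noteq> 0 \<longrightarrow> (\<exists>k. p = replicate d k))"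

definition mode_prod :: "ctensor \<Rightarrow> nat \<Rightarrow> complex mat \<Rightarrow> ctensor" where
  "mode_prod A i X = (\<lambda>p. \<Sum>k<dim_col X. A (p[i := k]) * X $$ (p ! i, k))"

text \<open>The product in modes \<open>0, \<dots>, d - 1\<close>, applied in this order.\<close>

definition mode_prods :: "nat \<Rightarrow> ctensor \<Rightarrow> (nat \<Rightarrow> complex mat) \<Rightarrow> ctensor" where
  "mode_prods d A X = fold (\<lambda>i B. mode_prod B i (X i)) [0..<d] A"

definition tensor_diag :: "nat \<Rightarrow> nat \<Rightarrow> ctensor \<Rightarrow> complex vec" where
  "tensor_diag d r W = vec r (\<lambda>p. W (replicate d p))"

definition euclidean_norm :: "complex vec \<Rightarrow> real" where
  "euclidean_norm v = sqrt (\<Sum>i<dim_vec v. (cmod (v $ i))\<^sup>2)"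

end

theory Submission
  imports Defs
begin

text \<open>
  Vary the factor \<open>U\<close> in mode \<open>i\<close> and keep all other factors at \<open>Q\<^sub>j I\<close>. Applying first
  \<open>(Q\<^sub>j\<^sup>H)\<^sup>\<dagger>\<close> and then \<open>(U\<^sup>(\<^sup>j\<^sup>))\<^sup>\<dagger>\<close> in mode \<open>j\<close> amounts to applying
  \<open>(Q\<^sub>j\<^sup>H U\<^sup>(\<^sup>j\<^sup>))\<^sup>T\<close>, up to complex conjugation. In a mode \<open>j \<noteq> i\<close> this is a truncated identity
  matrix, and since \<open>d > 1\<close> there is such a mode. It singles out one diagonal entry of the
  diagonal tensor, and the restricted function becomes
  \<open>h(U) = \<Sum>\<^sub>p c\<^sub>p \<bar>(Q\<^sup>H U)\<^sub>p\<^sub>p\<bar>\<^sup>2\<close> with \<open>c\<^sub>p = \<Sum>\<^sub>l \<alpha>\<^sub>l \<bar>D\<^sup>l\<^sub>p\<^sub>.\<^sub>.\<^sub>p\<bar>\<^sup>2 > 0\<close>; this is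
  \<open>cmod_diagonal_entry_other_modes_fixed\<close>. The choice of \<open>\<dagger>\<close> disappears because only moduli enter.

  The rest concerns this function alone (locale \<open>diagonal_overlap\<close>). Its Euclidean gradient \<open>E(U)\<close>
  has the columns \<open>2 c\<^sub>p q\<^sub>p q\<^sub>p\<^sup>H u\<^sub>p\<close>, and the Riemannian gradient is the projection
  \<open>E - U (U\<^sup>H E + E\<^sup>H U) / 2\<close>. Differentiating this formula at \<open>U = Q I\<close> and projecting again gives
  the Hessian. In the coordinates \<open>Y = Q\<^sup>H Z\<close> of a tangent vector \<open>Z\<close>, whose upper \<open>r \<times> r\<close> block
  is skew-Hermitian, the Hessian is diagonal: it annihilates the diagonal entries \<open>Y\<^sub>p\<^sub>p\<close>, multiplies
  \<open>Y\<^sub>i\<^sub>p\<close> by \<open>-(c\<^sub>i + c\<^sub>p)\<close> for \<open>i \<noteq> p\<close> in the upper block, and by \<open>-2 c\<^sub>p\<close> below it. None of the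
  factors off the diagonal vanishes. So the range consists of all tangent vectors whose coordinates
  have a zero diagonal, and these are parametrised freely by the \<open>Y\<^sub>i\<^sub>p\<close> with \<open>p < i\<close>. There are
  \<open>\<Sum>\<^sub>p 2 (n - 1 - p) = 2nr - r\<^sup>2 - r\<close> real parameters, where \<open>p\<close> runs over \<open>0, \<dots>, r - 1\<close>.

  Tangent vectors are by definition velocities of curves, so the description of the tangent space by
  \<open>X\<^sup>H Z + Z\<^sup>H X = 0\<close> (\<open>tangent_space_iff\<close>) has to be proved. Necessity follows by differentiating
  \<open>\<gamma>\<^sup>H \<gamma> = I\<close>. For sufficiency, \<open>Z = W X\<close> with a skew-Hermitian \<open>W\<close>, and the Cayley transform of
  \<open>W\<close> moves \<open>X\<close> along a suitable curve. The dimension count rests on \<open>dim_by_dual_functionals\<close>.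
\<close>

section \<open>Adjoints and the real inner product\<close>

lemma dim_row_mat_adjoint [simp]: "dim_row (mat_adjoint A) = dim_col A"
  and dim_col_mat_adjoint [simp]: "dim_col (mat_adjoint A) = dim_row A"
  by (simp_all add: mat_adjoint_def)

lemma mat_adjoint_carrier [simp]: "A \<in> carrier_mat n m \<Longrightarrow> mat_adjoint A \<in> carrier_mat m n"
  by (rule carrier_matI) auto

lemma index_mat_adjoint [simp]:
  fixes A :: "complex mat"
  assumes "i < dim_col A" "j < dim_row A"
  shows "mat_adjoint A $$ (i, j) = cnj (A $$ (j, i))"
  using assms by (simp add: mat_adjoint_def mat_of_rows_index conjugate_complex_def)

lemma mat_adjoint_mult:
  fixes A B :: "complex mat"
  assumes "A \<in> carrier_mat n m" "B \<in> carrier_mat m k"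
  shows "mat_adjoint (A * B) = mat_adjoint B * mat_adjoint A"
  using assms by (intro eq_matI) (auto simp: scalar_prod_def mult.commute)

lemma index_mult_mat_sum:
  fixes A B :: "'a :: semiring_0 mat"
  assumes "A \<in> carrier_mat n m" "B \<in> carrier_mat m k" "i < n" "j < k"
  shows "(A * B) $$ (i, j) = (\<Sum>l<m. A $$ (i, l) * B $$ (l, j))"
  using assms by (auto simp: scalar_prod_def atLeast0LessThan)

lemma index_mult_diagonal:
  fixes A S :: "complex mat"
  assumes A: "A \<in> carrier_mat m r" and S: "S \<in> carrier_mat r r"
    and diag: "\<And>a b. a < r \<Longrightarrow> b < r \<Longrightarrow> S $$ (a, b) = (if a = b then s b else 0)"
    and ij: "i < m" "j < r"
  shows "(A * S) $$ (i, j) = A $$ (i, j) * s j"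
proof -
  have "(A * S) $$ (i, j) = (\<Sum>l<r. if l = j then A $$ (i, l) * s j else 0)"
    unfolding index_mult_mat_sum[OF A S ij] using ij by (intro sum.cong) (auto simp: diag)
  then show ?thesis using ij by simp
qed

lemma index_adjoint_mult_sum:
  fixes X Y :: "complex mat"
  assumes "X \<in> carrier_mat n r" "Y \<in> carrier_mat n m" "i < r" "j < m"
  shows "(mat_adjoint X * Y) $$ (i, j) = (\<Sum>k<n. cnj (X $$ (k, i)) * Y $$ (k, j))"
  using assms by (auto simp: scalar_prod_def atLeast0LessThan)

lemma index_adjoint_mult_cnj:
  fixes X Y :: "complex mat"
  assumes "X \<in> carrier_mat n r" "Y \<in> carrier_mat n m" "i < r" "j < m"
  shows "(mat_adjoint X * Y) $$ (i, j) = cnj ((mat_adjoint Y * X) $$ (j, i))"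
  using index_adjoint_mult_sum[OF assms(1,2,3,4)] index_adjoint_mult_sum[OF assms(2,1,4,3)]
  by (simp add: mult.commute del: index_mult_mat(1))

lemma real_inner_mat_entries:
  assumes "X \<in> carrier_mat n r" "Y \<in> carrier_mat n r"
  shows "real_inner_mat X Y = (\<Sum>j<r. \<Sum>k<n. Re (cnj (X $$ (k, j)) * Y $$ (k, j)))"
  using assms
  by (auto simp: real_inner_mat_def mat_trace_def scalar_prod_def atLeast0LessThan
      simp del: complex_cnj_mult times_complex.sel intro!: sum.cong)

lemma real_inner_mat_add_left:
  assumes "X \<in> carrier_mat n r" "Y \<in> carrier_mat n r" "Z \<in> carrier_mat n r"
  shows "real_inner_mat (X + Y) Z = real_inner_mat X Z + real_inner_mat Y Z"
proof -
  have "real_inner_mat (X + Y) Z = (\<Sum>j<r. \<Sum>k<n.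
      Re (cnj (X $$ (k, j)) * Z $$ (k, j)) + Re (cnj (Y $$ (k, j)) * Z $$ (k, j)))"
    using assms by (subst real_inner_mat_entries[of _ n r])
      (auto intro!: sum.cong simp: distrib_right simp del: complex_cnj_mult times_complex.sel)
  then show ?thesis
    using assms by (simp add: real_inner_mat_entries[of _ n r] sum.distrib del: times_complex.sel)
qed

lemma real_inner_mat_adjoint_shift:
  assumes "A \<in> carrier_mat m n" "X \<in> carrier_mat n r" "Y \<in> carrier_mat m r"
  shows "real_inner_mat (A * X) Y = real_inner_mat X (mat_adjoint A * Y)"
proof -
  have "mat_adjoint (A * X) * Y = mat_adjoint X * (mat_adjoint A * Y)"
    using assms by (simp add: mat_adjoint_mult[of _ m n _ r] assoc_mult_mat[of _ r n _ m])
  then show ?thesis by (simp add: real_inner_mat_def)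
qed

text \<open>Exchanging the two indices in \<open>Re (\<Sum> cnj S\<^sub>a\<^sub>b K\<^sub>a\<^sub>b)\<close> changes the sign of every term. This is why
  \<open>X S\<close> with Hermitian \<open>S\<close> is normal to a Stiefel manifold at \<open>X\<close>.\<close>

lemma real_inner_mat_hermitian_skew:
  assumes "S \<in> carrier_mat r r" "K \<in> carrier_mat r r" "mat_adjoint S = S"
    and skew: "\<And>a b. a < r \<Longrightarrow> b < r \<Longrightarrow> K $$ (a, b) + cnj (K $$ (b, a)) = 0"
  shows "real_inner_mat S K = 0"
proof -
  have S: "S $$ (b, a) = cnj (S $$ (a, b))" if "a < r" "b < r" for a b
    using index_mat_adjoint[of b S a] assms(1,3) that by simp
  have K: "K $$ (b, a) = - cnj (K $$ (a, b))" if "a < r" "b < r" for a b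
    using skew[OF that(2,1)] by (simp add: eq_neg_iff_add_eq_0)
  let ?s = "\<lambda>a b. Re (cnj (S $$ (a, b)) * K $$ (a, b))"
  have "(\<Sum>b<r. \<Sum>a<r. ?s a b) = (\<Sum>b<r. \<Sum>a<r. - ?s b a)"
  proof (intro sum.cong refl)
    fix a b assume "b \<in> {..<r}" "a \<in> {..<r}"
    then show "?s a b = - ?s b a"
      using S[of a b] K[of a b] by (simp del: complex_cnj_mult)
  qed
  also have "\<dots> = - (\<Sum>b<r. \<Sum>a<r. ?s a b)"
    by (subst sum.swap) (simp only: sum_negf)
  finally show ?thesis
    using assms by (simp add: real_inner_mat_entries[of _ r r])
qed

section \<open>Entrywise derivatives of matrix-valued curves\<close>

lemma has_vector_derivative_cnj:
  fixes f :: "real \<Rightarrow> complex"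
  assumes "(f has_vector_derivative f') F"
  shows "((\<lambda>x. cnj (f x)) has_vector_derivative cnj f') F"
  using bounded_linear.has_vector_derivative[OF bounded_linear_cnj assms] .

lemma has_real_derivative_cmod_power2:
  assumes "(w has_vector_derivative w') (at t)"
  shows "((\<lambda>t. (cmod (w t))\<^sup>2) has_real_derivative 2 * Re (cnj (w t) * w')) (at t)"
proof -
  have Re: "((\<lambda>t. Re (w t)) has_real_derivative Re w') (at t)"
    and Im: "((\<lambda>t. Im (w t)) has_real_derivative Im w') (at t)"
    using bounded_linear.has_vector_derivative[OF bounded_linear_Re assms]
      bounded_linear.has_vector_derivative[OF bounded_linear_Im assms]
    by (simp_all only: has_real_derivative_iff_has_vector_derivative)
  have "((\<lambda>t. (Re (w t))\<^sup>2 + (Im (w t))\<^sup>2) has_real_derivative 2 * Re (cnj (w t) * w')) (at t)"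
    using DERIV_add[OF DERIV_power[OF Re, of 2] DERIV_power[OF Im, of 2]] by (simp add: algebra_simps)
  then show ?thesis
    unfolding cmod_power2 .
qed

lemma has_mat_derivD:
  assumes "has_mat_deriv n r \<gamma> Z t"
  shows "\<gamma> s \<in> carrier_mat n r" "Z \<in> carrier_mat n r"
    "i < n \<Longrightarrow> j < r \<Longrightarrow> ((\<lambda>s. \<gamma> s $$ (i, j)) has_vector_derivative Z $$ (i, j)) (at t)"
  using assms by (auto simp: has_mat_deriv_def)

lemma has_mat_deriv_const: "A \<in> carrier_mat n r \<Longrightarrow> has_mat_deriv n r (\<lambda>_. A) (0\<^sub>m n r) t"
  by (simp add: has_mat_deriv_def)

lemma has_mat_deriv_add:
  assumes A: "has_mat_deriv n r A A' t" and B: "has_mat_deriv n r B B' t"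
  shows "has_mat_deriv n r (\<lambda>s. A s + B s) (A' + B') t"
proof -
  note c = has_mat_derivD(1,2)[OF A] has_mat_derivD(1,2)[OF B]
  note [simp] = c[THEN carrier_matD(1)] c[THEN carrier_matD(2)]
  show ?thesis
    using c has_mat_derivD(3)[OF A] has_mat_derivD(3)[OF B]
    by (auto simp: has_mat_deriv_def intro!: has_vector_derivative_add)
qed

lemma has_mat_deriv_smult:
  assumes A: "has_mat_deriv n r A A' t"
  shows "has_mat_deriv n r (\<lambda>s. c \<cdot>\<^sub>m A s) (c \<cdot>\<^sub>m A') t"
proof -
  note c = has_mat_derivD(1,2)[OF A]
  note [simp] = c[THEN carrier_matD(1)] c[THEN carrier_matD(2)]
  show ?thesis
    using c has_mat_derivD(3)[OF A]
    by (auto simp: has_mat_deriv_def intro!: has_vector_derivative_mult_right)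
qed

lemma has_mat_deriv_adjoint:
  assumes A: "has_mat_deriv n r A A' t"
  shows "has_mat_deriv r n (\<lambda>s. mat_adjoint (A s)) (mat_adjoint A') t"
proof -
  note c = has_mat_derivD(1,2)[OF A]
  note [simp] = c[THEN carrier_matD(1)] c[THEN carrier_matD(2)]
  show ?thesis
    using c has_mat_derivD(3)[OF A]
    by (auto simp: has_mat_deriv_def intro!: has_vector_derivative_cnj)
qed

lemma has_mat_deriv_mult:
  assumes A: "has_mat_deriv n m A A' t" and B: "has_mat_deriv m r B B' t"
  shows "has_mat_deriv n r (\<lambda>s. A s * B s) (A' * B t + A t * B') t"
proof -
  note c = has_mat_derivD(1,2)[OF A] has_mat_derivD(1,2)[OF B]
  note [simp] = c[THEN carrier_matD(1)] c[THEN carrier_matD(2)]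
  have "((\<lambda>s. (A s * B s) $$ (i, j)) has_vector_derivative (A' * B t + A t * B') $$ (i, j)) (at t)"
    if "i < n" "j < r" for i j
  proof -
    have "((\<lambda>s. \<Sum>l<m. A s $$ (i, l) * B s $$ (l, j)) has_vector_derivative
        (\<Sum>l<m. A t $$ (i, l) * B' $$ (l, j) + A' $$ (i, l) * B t $$ (l, j))) (at t)"
      using that by (intro has_vector_derivative_sum has_vector_derivative_mult
          has_mat_derivD(3)[OF A] has_mat_derivD(3)[OF B]) auto
    then show ?thesis
      using that c by (simp add: index_mult_mat_sum[OF c(1) c(3)] index_mult_mat_sum[OF c(2) c(3)]
          index_mult_mat_sum[OF c(1) c(4)] sum.distrib add.commute del: index_mult_mat(1))
  qed
  moreover have "A s * B s \<in> carrier_mat n r" for s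
    using c by (intro mult_carrier_mat)
  moreover have "A' * B t + A t * B' \<in> carrier_mat n r"
    using c by (intro add_carrier_mat mult_carrier_mat)
  ultimately show ?thesis
    unfolding has_mat_deriv_def by blast
qed

lemma has_mat_deriv_const_mult:
  assumes A: "A \<in> carrier_mat n m" and B: "has_mat_deriv m r B B' t"
  shows "has_mat_deriv n r (\<lambda>s. A * B s) (A * B') t"
proof -
  have "0\<^sub>m n m * B t + A * B' = A * B'"
    using left_mult_zero_mat[OF has_mat_derivD(1)[OF B, of t], of n]
      left_add_zero_mat[OF mult_carrier_mat[OF A has_mat_derivD(2)[OF B]]] by simp
  with has_mat_deriv_mult[OF has_mat_deriv_const[OF A] B] show ?thesis by simp
qed

lemma has_mat_deriv_unique:
  assumes "has_mat_deriv n r A X t" "has_mat_deriv n r A Y t"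
  shows "X = Y"
proof (rule eq_matI)
  fix i j assume "i < dim_row Y" "j < dim_col Y"
  then have "i < n" "j < r" using has_mat_derivD(2)[OF assms(2)] by auto
  from assms[THEN has_mat_derivD(3), OF this] show "X $$ (i, j) = Y $$ (i, j)"
    unfolding has_vector_derivative_def
    by (drule_tac has_derivative_unique) (auto dest: fun_cong[of _ _ 1])
qed (use assms[THEN has_mat_derivD(2)] in auto)

text \<open>The function \<open>\<phi>\<close> is the difference quotient of \<open>x\<close> at \<open>0\<close>.\<close>

lemma has_vector_derivative_at_0_factor:
  fixes x :: "real \<Rightarrow> complex"
  assumes x: "\<And>t. x t = x0 + complex_of_real t * \<phi> t" and \<phi>: "(\<phi> \<longlongrightarrow> L) (at 0)"
  shows "(x has_vector_derivative L) (at 0)"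
  unfolding has_vector_derivative_def has_derivative_iff_norm
proof (intro conjI)
  show "bounded_linear (\<lambda>t. t *\<^sub>R L)" by (rule bounded_linear_scaleR_left)
  have lim: "((\<lambda>t. norm (\<phi> t - L)) \<longlongrightarrow> 0) (at 0)"
    using \<phi> by (intro tendsto_norm_zero) (simp add: LIM_zero)
  have "norm (\<phi> t - L) = norm (x t - x 0 - (t - 0) *\<^sub>R L) / norm (t - 0)" if "t \<noteq> 0" for t
  proof -
    have "x t - x 0 - (t - 0) *\<^sub>R L = complex_of_real t * (\<phi> t - L)"
      by (simp add: x scaleR_conv_of_real algebra_simps)
    then show ?thesis using that by (simp add: norm_mult)
  qed
  then have "\<forall>\<^sub>F t in at 0. norm (\<phi> t - L) = norm (x t - x 0 - (t - 0) *\<^sub>R L) / norm (t - 0)"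
    by (auto simp: eventually_at_filter)
  from tendsto_cong[OF this] lim
  show "((\<lambda>t. norm (x t - x 0 - (t - 0) *\<^sub>R L) / norm (t - 0)) \<longlongrightarrow> 0) (at 0)"
    by (rule iffD1)
qed

section \<open>Tangent spaces of Stiefel manifolds\<close>

lemma stiefelD:
  assumes "X \<in> stiefel r n"
  shows "X \<in> carrier_mat n r" "mat_adjoint X * X = 1\<^sub>m r"
  using assms by (auto simp: stiefel_def)

text \<open>The condition is the derivative of \<open>\<gamma>\<^sup>H \<gamma> = I\<close>.\<close>

lemma tangent_space_skew:
  assumes "Z \<in> tangent_space r n X"
  shows "X \<in> stiefel r n" "Z \<in> carrier_mat n r"
    "a < r \<Longrightarrow> b < r \<Longrightarrow> (mat_adjoint X * Z) $$ (a, b) + cnj ((mat_adjoint X * Z) $$ (b, a)) = 0"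
proof -
  obtain \<gamma> where \<gamma>: "\<gamma> t \<in> stiefel r n" "\<gamma> 0 = X" and d: "has_mat_deriv n r \<gamma> Z 0" for t
    using assms by (auto simp: tangent_space_def stiefel_curve_def)
  show X: "X \<in> stiefel r n" using \<gamma> by metis
  show Z: "Z \<in> carrier_mat n r" by (rule has_mat_derivD(2)[OF d])
  have "(\<lambda>t. mat_adjoint (\<gamma> t) * \<gamma> t) = (\<lambda>_. 1\<^sub>m r)"
    using stiefelD(2)[OF \<gamma>(1)] by auto
  with has_mat_deriv_mult[OF has_mat_deriv_adjoint[OF d] d]
  have "has_mat_deriv r r (\<lambda>_. 1\<^sub>m r) (mat_adjoint Z * X + mat_adjoint X * Z) 0"
    by (simp add: \<gamma>(2))
  then have eq: "mat_adjoint Z * X + mat_adjoint X * Z = 0\<^sub>m r r"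
    by (rule has_mat_deriv_unique[OF _ has_mat_deriv_const]) simp
  note X' = stiefelD(1)[OF X]
  assume ab: "a < r" "b < r"
  have "(mat_adjoint Z * X) $$ (a, b) = cnj ((mat_adjoint X * Z) $$ (b, a))"
    by (rule index_adjoint_mult_cnj[OF Z X' ab])
  moreover have "(mat_adjoint Z * X) $$ (a, b) + (mat_adjoint X * Z) $$ (a, b) = 0"
    using arg_cong[OF eq, of "\<lambda>M. M $$ (a, b)"] ab X' Z by (simp del: index_mult_mat(1))
  ultimately show "(mat_adjoint X * Z) $$ (a, b) + cnj ((mat_adjoint X * Z) $$ (b, a)) = 0"
    by (simp add: add.commute)
qed

section \<open>Cayley transforms as curves in Stiefel manifolds\<close>

text \<open>A skew-Hermitian matrix defines a skew-Hermitian sesquilinear form. With \<open>x = y\<close> the form takes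
  imaginary values, which makes \<open>1 - s W\<close> invertible for real \<open>s\<close>; with columns of matrices it gives
  the isometry of the Cayley transform.\<close>

lemma skew_form:
  fixes W :: "nat \<Rightarrow> nat \<Rightarrow> complex"
  assumes skew: "\<And>i j. i < n \<Longrightarrow> j < n \<Longrightarrow> W i j + cnj (W j i) = 0"
  shows "(\<Sum>i<n. cnj (x i) * (\<Sum>j<n. W i j * y j)) + cnj (\<Sum>i<n. cnj (y i) * (\<Sum>j<n. W i j * x j)) = 0"
proof -
  have "cnj (\<Sum>i<n. cnj (y i) * (\<Sum>j<n. W i j * x j)) = (\<Sum>i<n. \<Sum>j<n. y i * (cnj (W i j) * cnj (x j)))"
    by (simp add: sum_distrib_left)
  also have "\<dots> = (\<Sum>i<n. \<Sum>j<n. y j * (cnj (W j i) * cnj (x i)))"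
    by (rule sum.swap)
  also have "\<dots> = (\<Sum>i<n. \<Sum>j<n. - (cnj (x i) * (W i j * y j)))"
  proof (intro sum.cong refl)
    fix i j assume "i \<in> {..<n}" "j \<in> {..<n}"
    then have "cnj (W j i) = - W i j"
      using skew[of i j] by (simp add: eq_neg_iff_add_eq_0 add.commute)
    then show "y j * (cnj (W j i) * cnj (x i)) = - (cnj (x i) * (W i j * y j))" by simp
  qed
  also have "\<dots> = - (\<Sum>i<n. cnj (x i) * (\<Sum>j<n. W i j * y j))"
    by (simp only: sum_negf sum_distrib_left)
  finally show ?thesis by simp
qed

text \<open>The equation says \<open>(1 - s W) Y = (1 + s W) X\<close>, so that \<open>Y\<close> is the Cayley transform of \<open>s W\<close>
  applied to \<open>X\<close>. A vector with \<open>v = s W v\<close> satisfies \<open>\<parallel>v\<parallel>\<^sup>2 = s v\<^sup>H W v\<close>, where the left-hand side is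
  real and the right-hand side is imaginary; hence \<open>v = 0\<close> and \<open>1 - s W\<close> is invertible.\<close>

lemma cayley_solution:
  assumes W: "W \<in> carrier_mat n n" and X: "X \<in> carrier_mat n r"
    and skew: "\<And>i j. i < n \<Longrightarrow> j < n \<Longrightarrow> W $$ (i, j) + cnj (W $$ (j, i)) = 0"
  shows "\<exists>Y. Y \<in> carrier_mat n r \<and> (\<forall>i<n. \<forall>j<r.
    Y $$ (i, j) = X $$ (i, j) + complex_of_real s * (\<Sum>k<n. W $$ (i, k) * (Y $$ (k, j) + X $$ (k, j))))"
proof -
  define c where "c = complex_of_real s"
  define M where "M = 1\<^sub>m n + (- c) \<cdot>\<^sub>m W"
  have M: "M \<in> carrier_mat n n" using W by (simp add: M_def)
  have Mi: "M $$ (i, k) = (if i = k then 1 else 0) - c * W $$ (i, k)" if "i < n" "k < n" for i k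
    using W that by (simp add: M_def)
  have Msum: "(\<Sum>k<n. M $$ (i, k) * v k) = v i - c * (\<Sum>k<n. W $$ (i, k) * v k)" if "i < n" for i v
  proof -
    have "(\<Sum>k<n. M $$ (i, k) * v k) = (\<Sum>k<n. (if i = k then v k else 0) - c * (W $$ (i, k) * v k))"
      using that by (intro sum.cong) (auto simp: Mi algebra_simps)
    then show ?thesis
      using that by (simp add: sum_subtractf sum_distrib_left sum.delta)
  qed
  have "det M \<noteq> 0"
  proof
    assume "det M = 0"
    then obtain v where v: "v \<in> carrier_vec n" "v \<noteq> 0\<^sub>v n" "M *\<^sub>v v = 0\<^sub>v n"
      using det_0_iff_vec_prod_zero[OF M] by auto
    have vi: "v $ i = c * (\<Sum>k<n. W $$ (i, k) * v $ k)" if i: "i < n" for i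
    proof -
      have "(\<Sum>k<n. M $$ (i, k) * v $ k) = (M *\<^sub>v v) $ i"
        using i v(1) M by (auto simp: scalar_prod_def atLeast0LessThan)
      then show ?thesis using Msum[OF i, of "\<lambda>k. v $ k"] v(3) i by simp
    qed
    define q where "q = (\<Sum>i<n. cnj (v $ i) * (\<Sum>k<n. W $$ (i, k) * v $ k))"
    have "q + cnj q = 0"
      unfolding q_def by (rule skew_form) (rule skew)
    then have Req: "Re q = 0" by (simp add: complex_eq_iff)
    have "(\<Sum>i<n. cnj (v $ i) * v $ i) = c * q"
      unfolding q_def sum_distrib_left[of c]
    proof (intro sum.cong refl)
      fix i assume "i \<in> {..<n}"
      then have "cnj (v $ i) * v $ i = cnj (v $ i) * (c * (\<Sum>k<n. W $$ (i, k) * v $ k))"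
        using vi[of i] by (simp only: lessThan_iff)
      then show "cnj (v $ i) * v $ i = c * (cnj (v $ i) * (\<Sum>k<n. W $$ (i, k) * v $ k))"
        by (simp only: mult.left_commute)
    qed
    moreover have "cnj (v $ i) * v $ i = complex_of_real ((cmod (v $ i))\<^sup>2)" for i
      by (metis complex_norm_square mult.commute)
    ultimately have "complex_of_real (\<Sum>i<n. (cmod (v $ i))\<^sup>2) = c * q" by simp
    then have "(\<Sum>i<n. (cmod (v $ i))\<^sup>2) = Re (c * q)" by (metis Re_complex_of_real)
    also have "\<dots> = 0" using Req by (simp add: c_def)
    finally have "\<forall>i<n. v $ i = 0" by (subst (asm) sum_nonneg_eq_0_iff) auto
    then have "v = 0\<^sub>v n" using v(1) by (intro eq_vecI) auto
    with v(2) show False by simp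
  qed
  from det_non_zero_imp_unit[OF M this, of "()"]
  obtain B where B: "B \<in> carrier_mat n n" "M * B = 1\<^sub>m n"
    unfolding Units_def ring_mat_def by auto
  define N where "N = X + c \<cdot>\<^sub>m (W * X)"
  have N: "N \<in> carrier_mat n r" using W X by (simp add: N_def)
  have "M * (B * N) = N"
    using assoc_mult_mat[OF M B(1) N] B(2) N by simp
  note BN = mult_carrier_mat[OF B(1) N]
  have "(B * N) $$ (i, j) = X $$ (i, j) + c * (\<Sum>k<n. W $$ (i, k) * ((B * N) $$ (k, j) + X $$ (k, j)))"
    if ij: "i < n" "j < r" for i j
  proof -
    have "N $$ (i, j) = (\<Sum>k<n. M $$ (i, k) * (B * N) $$ (k, j))"
      using index_mult_mat_sum[OF M BN ij] \<open>M * (B * N) = N\<close> by simp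
    also have "\<dots> = (B * N) $$ (i, j) - c * (\<Sum>k<n. W $$ (i, k) * (B * N) $$ (k, j))"
      by (rule Msum[OF ij(1)])
    also have "N $$ (i, j) = X $$ (i, j) + c * (\<Sum>k<n. W $$ (i, k) * X $$ (k, j))"
      using ij W X index_mult_mat_sum[OF W X ij] by (simp add: N_def del: index_mult_mat(1))
    finally show ?thesis
      by (simp add: distrib_left sum.distrib algebra_simps del: index_mult_mat(1))
  qed
  then show ?thesis using BN unfolding c_def by blast
qed

text \<open>With \<open>G = Y + X\<close> and \<open>Y - X = s W G\<close>, the identity
  \<open>2 (Y\<^sup>H Y - X\<^sup>H X) = G\<^sup>H (Y - X) + (Y - X)\<^sup>H G\<close> shows that \<open>Y\<^sup>H Y = X\<^sup>H X\<close>, because \<open>G\<^sup>H W G\<close> is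
  skew-Hermitian.\<close>

lemma cayley_stiefel:
  assumes W: "W \<in> carrier_mat n n" and X: "X \<in> stiefel r n" and Y: "Y \<in> carrier_mat n r"
    and skew: "\<And>i j. i < n \<Longrightarrow> j < n \<Longrightarrow> W $$ (i, j) + cnj (W $$ (j, i)) = 0"
    and eq: "\<And>i j. i < n \<Longrightarrow> j < r \<Longrightarrow>
      Y $$ (i, j) = X $$ (i, j) + complex_of_real s * (\<Sum>k<n. W $$ (i, k) * (Y $$ (k, j) + X $$ (k, j)))"
  shows "Y \<in> stiefel r n"
proof -
  note X' = stiefelD(1)[OF X]
  have "mat_adjoint Y * Y = mat_adjoint X * X"
  proof (rule eq_matI)
    fix a b assume "a < dim_row (mat_adjoint X * X)" "b < dim_col (mat_adjoint X * X)"
    then have ab: "a < r" "b < r" using X' by auto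
    let ?G = "\<lambda>j k. Y $$ (k, j) + X $$ (k, j)"
    let ?q = "\<lambda>a b. \<Sum>k<n. cnj (?G a k) * (\<Sum>l<n. W $$ (k, l) * ?G b l)"
    have D: "Y $$ (k, j) - X $$ (k, j) = complex_of_real s * (\<Sum>l<n. W $$ (k, l) * ?G j l)"
      if "k < n" "j < r" for k j
      using eq[OF that] by simp
    have "2 * ((\<Sum>k<n. cnj (Y $$ (k, a)) * Y $$ (k, b)) - (\<Sum>k<n. cnj (X $$ (k, a)) * X $$ (k, b)))
      = (\<Sum>k<n. cnj (?G a k) * (Y $$ (k, b) - X $$ (k, b)) + cnj (cnj (?G b k) * (Y $$ (k, a) - X $$ (k, a))))"
      unfolding sum_subtractf[symmetric] sum_distrib_left
      by (intro sum.cong) (auto simp: algebra_simps)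
    also have "\<dots> = (\<Sum>k<n. complex_of_real s * (cnj (?G a k) * (\<Sum>l<n. W $$ (k, l) * ?G b l))
        + complex_of_real s * cnj (cnj (?G b k) * (\<Sum>l<n. W $$ (k, l) * ?G a l)))"
      using ab by (intro sum.cong refl) (simp add: D mult.left_commute del: cnj_sum)
    also have "\<dots> = complex_of_real s * (?q a b + cnj (?q b a))"
      by (simp only: sum.distrib sum_distrib_left[symmetric] cnj_sum[symmetric] distrib_left)
    also have "?q a b + cnj (?q b a) = 0"
      by (rule skew_form) (rule skew)
    finally have "(\<Sum>k<n. cnj (Y $$ (k, a)) * Y $$ (k, b)) = (\<Sum>k<n. cnj (X $$ (k, a)) * X $$ (k, b))"
      by simp
    then show "(mat_adjoint Y * Y) $$ (a, b) = (mat_adjoint X * X) $$ (a, b)"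
      using index_adjoint_mult_sum[OF Y Y ab] index_adjoint_mult_sum[OF X' X' ab] by simp
  qed (use X' Y in auto)
  then show ?thesis using X Y by (simp add: stiefel_def)
qed

lemma stiefel_entry_le_1:
  assumes X: "X \<in> stiefel r n" and ij: "i < n" "j < r"
  shows "cmod (X $$ (i, j)) \<le> 1"
proof -
  note X' = stiefelD(1)[OF X]
  have "complex_of_real (\<Sum>k<n. (cmod (X $$ (k, j)))\<^sup>2) = (mat_adjoint X * X) $$ (j, j)"
    unfolding index_adjoint_mult_sum[OF X' X' ij(2) ij(2)]
    by (simp only: of_real_sum complex_norm_square mult.commute)
  also have "\<dots> = 1" using stiefelD(2)[OF X] ij by simp
  finally have "(\<Sum>k<n. (cmod (X $$ (k, j)))\<^sup>2) = 1" by (metis of_real_eq_1_iff)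
  moreover have "(cmod (X $$ (i, j)))\<^sup>2 \<le> (\<Sum>k<n. (cmod (X $$ (k, j)))\<^sup>2)"
    using ij by (intro member_le_sum) auto
  ultimately show ?thesis by (metis abs_norm_cancel abs_square_le_1)
qed

text \<open>One may take \<open>W = V X\<^sup>H - X V\<^sup>H\<close> with \<open>V = Z - X X\<^sup>H Z / 2\<close>. The correction by half of the component
  along \<open>X\<close> is needed because that component contributes to \<open>W X\<close> twice.\<close>

lemma skew_generator:
  assumes X: "X \<in> stiefel r n" and Z: "Z \<in> carrier_mat n r"
    and skew: "\<And>a b. a < r \<Longrightarrow> b < r \<Longrightarrow>
      (mat_adjoint X * Z) $$ (a, b) + cnj ((mat_adjoint X * Z) $$ (b, a)) = 0"
  obtains W where "W \<in> carrier_mat n n" "W * X = Z"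
    "\<And>i j. i < n \<Longrightarrow> j < n \<Longrightarrow> W $$ (i, j) + cnj (W $$ (j, i)) = 0"
proof -
  note X' = stiefelD[OF X]
  have XH: "mat_adjoint X \<in> carrier_mat r n" using X' by simp
  define S where "S = mat_adjoint X * Z"
  have S: "S \<in> carrier_mat r r" using XH Z by (simp add: S_def)
  define V where "V = Z - (1/2) \<cdot>\<^sub>m (X * S)"
  have XS: "X * S \<in> carrier_mat n r" using X' S by simp
  have V: "V \<in> carrier_mat n r" using Z XS by (simp add: V_def minus_carrier_mat)
  have VH: "mat_adjoint V \<in> carrier_mat r n" using V by simp
  note [simp] = carrier_matD[OF X'(1)] carrier_matD[OF V] carrier_matD[OF S] carrier_matD[OF Z]
  define W where "W = V * mat_adjoint X - X * mat_adjoint V"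
  have c1: "V * mat_adjoint X \<in> carrier_mat n n" and c2: "X * mat_adjoint V \<in> carrier_mat n n"
    using V VH X' XH by auto
  have W: "W \<in> carrier_mat n n" unfolding W_def using c2 by (rule minus_carrier_mat)
  have "W $$ (i, j) + cnj (W $$ (j, i)) = 0" if "i < n" "j < n" for i j
  proof -
    have "(X * mat_adjoint V) $$ (i, j) = cnj ((V * mat_adjoint X) $$ (j, i))" if "i < n" "j < n" for i j
      using that X' V VH XH unfolding index_mult_mat_sum[OF X'(1) VH that] index_mult_mat_sum[OF V XH that(2,1)]
      by (auto simp: mult.commute intro!: sum.cong)
    note this[OF that] this[OF that(2,1)]
    then show ?thesis using that by (simp add: W_def del: index_mult_mat(1))
  qed
  moreover have "W * X = Z"
  proof -
    have XHV: "mat_adjoint X * V = (1/2) \<cdot>\<^sub>m S"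
    proof -
      have "mat_adjoint X * (X * S) = S"
        using X' XH S by (simp add: assoc_mult_mat[OF XH X'(1) S, symmetric])
      then have "mat_adjoint X * V = S - (1/2) \<cdot>\<^sub>m S"
        using XH Z XS S by (simp add: V_def mult_minus_distrib_mat[OF XH Z] mult_smult_distrib[OF XH XS] S_def[symmetric])
      then show ?thesis using S by (intro eq_matI) (auto simp: field_simps)
    qed
    have "mat_adjoint V * X = - ((1/2) \<cdot>\<^sub>m S)"
    proof (rule eq_matI)
      fix a b assume "a < dim_row (- ((1/2) \<cdot>\<^sub>m S))" "b < dim_col (- ((1/2) \<cdot>\<^sub>m S))"
      then have ab: "a < r" "b < r" using S by auto
      have "(mat_adjoint V * X) $$ (a, b) = cnj ((mat_adjoint X * V) $$ (b, a))"
        by (rule index_adjoint_mult_cnj[OF V X'(1) ab])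
      also have "\<dots> = (1/2) * cnj (S $$ (b, a))" using S ab by (simp add: XHV)
      also have "cnj (S $$ (b, a)) = - S $$ (a, b)"
        using skew[OF ab] by (simp add: S_def eq_neg_iff_add_eq_0 add.commute)
      finally show "(mat_adjoint V * X) $$ (a, b) = (- ((1/2) \<cdot>\<^sub>m S)) $$ (a, b)" using S ab by simp
    qed (use V X' S in auto)
    then have "X * mat_adjoint V * X = - ((1/2) \<cdot>\<^sub>m (X * S))"
      using X' S by (simp add: assoc_mult_mat[OF X'(1) VH X'(1)] mult_smult_distrib[OF X'(1) S])
    moreover have "V * mat_adjoint X * X = V"
      using V X' by (simp add: assoc_mult_mat[OF V XH X'(1)])
    ultimately have "W * X = V - - ((1/2) \<cdot>\<^sub>m (X * S))"
      by (simp add: W_def minus_mult_distrib_mat[OF c1 c2 X'(1)])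
    also have "\<dots> = Z" using Z XS by (intro eq_matI) (auto simp: V_def)
    finally show ?thesis .
  qed
  ultimately show ?thesis using W that by blast
qed

text \<open>The curve is \<open>\<gamma> t = (1 - (t/2) W)\<^sup>-\<^sup>1 (1 + (t/2) W) X\<close>. From \<open>\<gamma> t - X = (t/2) W (\<gamma> t + X)\<close> and
  the boundedness of the entries of \<open>\<gamma> t\<close> one first obtains continuity at \<open>0\<close> and then, from the same
  equation divided by \<open>t\<close>, the derivative \<open>W X = Z\<close>.\<close>

lemma tangent_spaceI:
  assumes X: "X \<in> stiefel r n" and Z: "Z \<in> carrier_mat n r"
    and skew: "\<And>a b. a < r \<Longrightarrow> b < r \<Longrightarrow>
      (mat_adjoint X * Z) $$ (a, b) + cnj ((mat_adjoint X * Z) $$ (b, a)) = 0"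
  shows "Z \<in> tangent_space r n X"
proof -
  obtain W where W: "W \<in> carrier_mat n n" "W * X = Z"
    and Wskew: "\<And>i j. i < n \<Longrightarrow> j < n \<Longrightarrow> W $$ (i, j) + cnj (W $$ (j, i)) = 0"
    by (rule skew_generator[OF X Z skew], assumption, assumption, rule that)
  note X' = stiefelD(1)[OF X]
  have "\<forall>t. \<exists>Y. Y \<in> carrier_mat n r \<and> (\<forall>i<n. \<forall>j<r. Y $$ (i, j) = X $$ (i, j) +
      complex_of_real (t / 2) * (\<Sum>k<n. W $$ (i, k) * (Y $$ (k, j) + X $$ (k, j))))"
    by (intro allI cayley_solution[OF W(1) X' Wskew])
  from choice[OF this] obtain \<gamma> where \<gamma>: "\<gamma> t \<in> carrier_mat n r"
    and eq: "\<And>i j. i < n \<Longrightarrow> j < r \<Longrightarrow> \<gamma> t $$ (i, j) = X $$ (i, j) +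
      complex_of_real (t / 2) * (\<Sum>k<n. W $$ (i, k) * (\<gamma> t $$ (k, j) + X $$ (k, j)))" for t
    by blast
  have st: "\<gamma> t \<in> stiefel r n" for t
    by (rule cayley_stiefel[OF W(1) X \<gamma> Wskew eq])
  have "\<gamma> 0 = X"
    using \<gamma>[of 0] X' eq[of _ _ 0] by (intro eq_matI) auto
  moreover have "((\<lambda>t. \<gamma> t $$ (i, j)) has_vector_derivative Z $$ (i, j)) (at 0)" if ij: "i < n" "j < r" for i j
  proof (rule has_vector_derivative_at_0_factor)
    let ?\<phi> = "\<lambda>i t. 1/2 * (\<Sum>k<n. W $$ (i, k) * (\<gamma> t $$ (k, j) + X $$ (k, j)))"
    show "\<gamma> t $$ (i, j) = X $$ (i, j) + complex_of_real t * ?\<phi> i t" for t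
      using eq[OF ij, of t] by simp
    have lim: "((\<lambda>t. \<gamma> t $$ (k, j)) \<longlongrightarrow> X $$ (k, j)) (at 0)" if k: "k < n" for k
    proof -
      define C where "C = (\<Sum>l<n. cmod (W $$ (k, l)))"
      have "cmod (\<gamma> t $$ (k, j) - X $$ (k, j)) \<le> \<bar>t\<bar> * C" for t
      proof -
        have "cmod (\<Sum>l<n. W $$ (k, l) * (\<gamma> t $$ (l, j) + X $$ (l, j))) \<le> (\<Sum>l<n. cmod (W $$ (k, l)) * 2)"
        proof (intro sum_norm_le)
          fix l assume "l \<in> {..<n}"
          then have "cmod (\<gamma> t $$ (l, j) + X $$ (l, j)) \<le> 1 + 1"
            using ij by (intro norm_triangle_mono stiefel_entry_le_1[OF st] stiefel_entry_le_1[OF X]) auto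
          then show "cmod (W $$ (k, l) * (\<gamma> t $$ (l, j) + X $$ (l, j))) \<le> cmod (W $$ (k, l)) * 2"
            by (simp add: norm_mult mult_left_mono)
        qed
        also have "\<dots> = C * 2" by (simp add: C_def sum_distrib_right)
        finally have "cmod (\<Sum>l<n. W $$ (k, l) * (\<gamma> t $$ (l, j) + X $$ (l, j))) \<le> C * 2" .
        from mult_left_mono[OF this, of "\<bar>t\<bar> / 2"] show ?thesis
          unfolding eq[OF k ij(2), of t] by (simp add: norm_mult norm_divide)
      qed
      moreover have "0 \<le> C" by (simp add: C_def sum_nonneg)
      ultimately have "\<forall>t. norm (\<gamma> t $$ (k, j) - X $$ (k, j)) \<le> norm (\<bar>t\<bar> * C) * 1"
        by simp
      moreover have "((\<lambda>t. \<bar>t\<bar> * C) \<longlongrightarrow> 0) (at 0)"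
        by (auto intro!: tendsto_eq_intros)
      ultimately have "((\<lambda>t. \<gamma> t $$ (k, j) - X $$ (k, j)) \<longlongrightarrow> 0) (at 0)"
        by (rule_tac tendsto_0_le[OF _ always_eventually])
      then show ?thesis by (simp add: LIM_zero_iff)
    qed
    have "(?\<phi> i \<longlongrightarrow> 1/2 * (\<Sum>k<n. W $$ (i, k) * (X $$ (k, j) + X $$ (k, j)))) (at 0)"
      using lim by (intro tendsto_intros) auto
    also have "1/2 * (\<Sum>k<n. W $$ (i, k) * (X $$ (k, j) + X $$ (k, j))) = Z $$ (i, j)"
      unfolding W(2)[symmetric] index_mult_mat_sum[OF W(1) X' ij] by (simp add: sum_distrib_left)
    finally show "(?\<phi> i \<longlongrightarrow> Z $$ (i, j)) (at 0)" .
  qed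
  ultimately show ?thesis
    using st \<gamma> Z by (auto simp: tangent_space_def stiefel_curve_def has_mat_deriv_def)
qed

lemma tangent_space_iff:
  assumes "X \<in> stiefel r n"
  shows "Z \<in> tangent_space r n X \<longleftrightarrow> Z \<in> carrier_mat n r \<and>
    (\<forall>a<r. \<forall>b<r. (mat_adjoint X * Z) $$ (a, b) + cnj ((mat_adjoint X * Z) $$ (b, a)) = 0)"
  using tangent_space_skew(2,3)[of Z r n X] tangent_spaceI[OF assms, of Z] by blast

section \<open>Tangent spaces as real vector spaces\<close>

lemma tangent_space_zero:
  assumes "X \<in> stiefel r n"
  shows "0\<^sub>m n r \<in> tangent_space r n X"
proof (rule tangent_spaceI[OF assms])
  have "mat_adjoint X * 0\<^sub>m n r = 0\<^sub>m r r"
    using stiefelD(1)[OF assms] by (intro right_mult_zero_mat) simp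
  then show "(mat_adjoint X * 0\<^sub>m n r) $$ (a, b) + cnj ((mat_adjoint X * 0\<^sub>m n r) $$ (b, a)) = 0"
    if "a < r" "b < r" for a b
    using that by (simp del: index_mult_mat(1))
qed simp

lemma tangent_space_add:
  assumes Y: "Y \<in> tangent_space r n X" and Z: "Z \<in> tangent_space r n X"
  shows "Y + Z \<in> tangent_space r n X"
proof (rule tangent_spaceI[OF tangent_space_skew(1)[OF Y]])
  note c = tangent_space_skew(2)[OF Y] tangent_space_skew(2)[OF Z]
  have XH: "mat_adjoint X \<in> carrier_mat r n"
    using stiefelD(1)[OF tangent_space_skew(1)[OF Y]] by simp
  show "Y + Z \<in> carrier_mat n r" using c by (intro add_carrier_mat)
  note [simp] = carrier_matD[OF XH, simplified] carrier_matD[OF c(1)] carrier_matD[OF c(2)]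
  show "(mat_adjoint X * (Y + Z)) $$ (a, b) + cnj ((mat_adjoint X * (Y + Z)) $$ (b, a)) = 0"
    if "a < r" "b < r" for a b
    using that tangent_space_skew(3)[OF Y that] tangent_space_skew(3)[OF Z that]
    by (simp add: mult_add_distrib_mat[OF XH c] algebra_simps del: index_mult_mat(1))
qed

lemma tangent_space_smult:
  assumes Z: "Z \<in> tangent_space r n X"
  shows "complex_of_real s \<cdot>\<^sub>m Z \<in> tangent_space r n X"
proof (rule tangent_spaceI[OF tangent_space_skew(1)[OF Z]])
  note c = tangent_space_skew(2)[OF Z]
  have XH: "mat_adjoint X \<in> carrier_mat r n"
    using stiefelD(1)[OF tangent_space_skew(1)[OF Z]] by simp
  show "complex_of_real s \<cdot>\<^sub>m Z \<in> carrier_mat n r" using c by simp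
  note [simp] = carrier_matD[OF XH, simplified] carrier_matD[OF c]
  show "(mat_adjoint X * (complex_of_real s \<cdot>\<^sub>m Z)) $$ (a, b)
      + cnj ((mat_adjoint X * (complex_of_real s \<cdot>\<^sub>m Z)) $$ (b, a)) = 0"
    if "a < r" "b < r" for a b
    using that tangent_space_skew(3)[OF Z that]
    by (simp add: mult_smult_distrib[OF XH c] distrib_left[symmetric] del: index_mult_mat(1))
qed

lemma vectorspace_tangent_module:
  assumes X: "X \<in> stiefel r n"
  shows "vectorspace class_ring (tangent_module r n X)"
proof -
  note c = tangent_space_skew(2)[of _ r n X]
  have neg: "\<exists>Y\<in>tangent_space r n X. Z + Y = 0\<^sub>m n r" if "Z \<in> tangent_space r n X" for Z
  proof
    show "Z + complex_of_real (- 1) \<cdot>\<^sub>m Z = 0\<^sub>m n r"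
      using c[OF that] by (intro eq_matI) auto
    show "complex_of_real (- 1) \<cdot>\<^sub>m Z \<in> tangent_space r n X"
      by (rule tangent_space_smult[OF that])
  qed
  have smult_smult: "complex_of_real (s * u) \<cdot>\<^sub>m Z = complex_of_real s \<cdot>\<^sub>m (complex_of_real u \<cdot>\<^sub>m Z)"
    and one: "complex_of_real 1 \<cdot>\<^sub>m Z = Z" for s u Z
    by (rule eq_matI; simp)+
  have dist: "complex_of_real (s + u) \<cdot>\<^sub>m Z = complex_of_real s \<cdot>\<^sub>m Z + complex_of_real u \<cdot>\<^sub>m Z"
    if "Z \<in> tangent_space r n X" for s u Z
    using add_smult_distrib_right_mat[OF c[OF that]] by simp
  let ?T = "tangent_space r n X"
  have "Module.module class_ring (tangent_module r n X)"
  proof (rule module_criteria, rule class_cring.cring_axioms,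
      simp_all only: tangent_module_def partial_object.simps monoid.simps ring.simps module.simps
        UNIV_I simp_thms True_implies_equals)
    show "0\<^sub>m n r \<in> ?T" by (rule tangent_space_zero[OF X])
    show "\<forall>Y Z. Y \<in> ?T \<and> Z \<in> ?T \<longrightarrow> Y + Z \<in> ?T" by (blast intro: tangent_space_add)
    show "\<forall>Z\<in>?T. \<exists>Y\<in>?T. Z + Y = 0\<^sub>m n r" using neg by blast
    show "\<forall>s Z. Z \<in> ?T \<longrightarrow> complex_of_real s \<cdot>\<^sub>m Z \<in> ?T" by (blast intro: tangent_space_smult)
    show "\<forall>Y Z. Y \<in> ?T \<and> Z \<in> ?T \<longrightarrow> Y + Z = Z + Y" using comm_add_mat[OF c c] by blast
    show "\<forall>W Y Z. W \<in> ?T \<and> Y \<in> ?T \<and> Z \<in> ?T \<longrightarrow> W + Y + Z = W + (Y + Z)"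
      using assoc_add_mat[OF c c c] by blast
    show "\<forall>Z\<in>?T. Z + 0\<^sub>m n r = Z" using right_add_zero_mat[OF c] by blast
    show "\<forall>s u Z. Z \<in> ?T \<longrightarrow> complex_of_real (s * u) \<cdot>\<^sub>m Z = complex_of_real s \<cdot>\<^sub>m (complex_of_real u \<cdot>\<^sub>m Z)"
      using smult_smult by blast
    show "\<forall>Z\<in>?T. complex_of_real 1 \<cdot>\<^sub>m Z = Z" using one by blast
    show "\<forall>s u Z. Z \<in> ?T \<longrightarrow> complex_of_real (s + u) \<cdot>\<^sub>m Z = complex_of_real s \<cdot>\<^sub>m Z + complex_of_real u \<cdot>\<^sub>m Z"
      using dist by blast
    show "\<forall>s Y Z. Y \<in> ?T \<and> Z \<in> ?T \<longrightarrow>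
        complex_of_real s \<cdot>\<^sub>m (Y + Z) = complex_of_real s \<cdot>\<^sub>m Y + complex_of_real s \<cdot>\<^sub>m Z"
      using add_smult_distrib_left_mat[OF c c] by blast
  qed
  then show ?thesis
    using class_field by (simp add: vectorspace_def)
qed

section \<open>Gradients obtained by projection\<close>

text \<open>The orthogonal projection of \<open>E\<close> onto the tangent space at \<open>X\<close>: it removes the normal part
  \<open>X S\<close>, where \<open>S\<close> is the Hermitian part of \<open>X\<^sup>H E\<close>.\<close>

definition stiefel_proj :: "complex mat \<Rightarrow> complex mat \<Rightarrow> complex mat" where
  "stiefel_proj X E = E + (- 1/2) \<cdot>\<^sub>m (X * (mat_adjoint X * E + mat_adjoint E * X))"

lemma stiefel_proj_hermitian_part:
  fixes X E :: "complex mat"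
  assumes X: "X \<in> carrier_mat n r" and E: "E \<in> carrier_mat n r"
  defines "S \<equiv> mat_adjoint X * E + mat_adjoint E * X"
  shows "S \<in> carrier_mat r r"
    "a < r \<Longrightarrow> b < r \<Longrightarrow> S $$ (a, b) = (mat_adjoint X * E) $$ (a, b) + cnj ((mat_adjoint X * E) $$ (b, a))"
proof -
  show "S \<in> carrier_mat r r"
    using X E unfolding S_def by (intro add_carrier_mat mult_carrier_mat[of _ r n] mat_adjoint_carrier)
  assume ab: "a < r" "b < r"
  note [simp] = carrier_matD[OF X] carrier_matD[OF E]
  have "S $$ (a, b) = (mat_adjoint X * E) $$ (a, b) + (mat_adjoint E * X) $$ (a, b)"
    using ab unfolding S_def by (intro index_add_mat(1)) auto
  then show "S $$ (a, b) = (mat_adjoint X * E) $$ (a, b) + cnj ((mat_adjoint X * E) $$ (b, a))"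
    using index_adjoint_mult_cnj[OF E X ab] by simp
qed

lemma stiefel_proj_carrier:
  assumes X: "X \<in> carrier_mat n r" and E: "E \<in> carrier_mat n r"
  shows "stiefel_proj X E \<in> carrier_mat n r"
  unfolding stiefel_proj_def
  by (intro add_carrier_mat smult_carrier_mat mult_carrier_mat[OF X] stiefel_proj_hermitian_part(1)[OF X E])

lemma stiefel_proj_tangent:
  assumes X: "X \<in> stiefel r n" and E: "E \<in> carrier_mat n r"
  shows "stiefel_proj X E \<in> tangent_space r n X"
proof (rule tangent_spaceI[OF X])
  note X' = stiefelD[OF X]
  show "stiefel_proj X E \<in> carrier_mat n r" by (rule stiefel_proj_carrier[OF X'(1) E])
  define S where "S = mat_adjoint X * E + mat_adjoint E * X"
  note S = stiefel_proj_hermitian_part[OF X'(1) E, folded S_def]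
  have XH: "mat_adjoint X \<in> carrier_mat r n" using X'(1) by simp
  note XS = mult_carrier_mat[OF X'(1) S(1)]
  have "mat_adjoint X * (X * S) = S"
    using assoc_mult_mat[OF XH X'(1) S(1)] X'(2) S(1) by simp
  then have eq: "mat_adjoint X * stiefel_proj X E = mat_adjoint X * E + (- 1/2) \<cdot>\<^sub>m S"
    unfolding stiefel_proj_def S_def[symmetric]
    using mult_add_distrib_mat[OF XH E smult_carrier_mat[OF XS]] mult_smult_distrib[OF XH XS] by simp
  note [simp] = carrier_matD[OF X'(1)] carrier_matD[OF E] carrier_matD[OF S(1)]
  show "(mat_adjoint X * stiefel_proj X E) $$ (a, b) + cnj ((mat_adjoint X * stiefel_proj X E) $$ (b, a)) = 0"
    if "a < r" "b < r" for a b
    using that S(2)[OF that] S(2)[OF that(2,1)]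
    by (simp add: eq field_simps del: index_mult_mat(1))
qed

lemma real_inner_mat_normal:
  assumes Z: "Z \<in> tangent_space r n X" and S: "S \<in> carrier_mat r r"
    and herm: "\<And>a b. a < r \<Longrightarrow> b < r \<Longrightarrow> S $$ (a, b) = cnj (S $$ (b, a))"
  shows "real_inner_mat (X * S) Z = 0"
proof -
  note X = stiefelD(1)[OF tangent_space_skew(1)[OF Z]]
  have XH: "mat_adjoint X \<in> carrier_mat r n" using X by simp
  have "mat_adjoint S = S"
    using S by (intro eq_matI) (auto intro: herm[symmetric])
  then show ?thesis
    unfolding real_inner_mat_adjoint_shift[OF X S tangent_space_skew(2)[OF Z]]
    by (intro real_inner_mat_hermitian_skew[OF S mult_carrier_mat[OF XH tangent_space_skew(2)[OF Z]]]
        tangent_space_skew(3)[OF Z])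
qed

lemma stiefel_proj_inner:
  assumes Z: "Z \<in> tangent_space r n X" and E: "E \<in> carrier_mat n r"
  shows "real_inner_mat (stiefel_proj X E) Z = real_inner_mat E Z"
proof -
  note X = stiefelD(1)[OF tangent_space_skew(1)[OF Z]]
  define S where "S = mat_adjoint X * E + mat_adjoint E * X"
  note S = stiefel_proj_hermitian_part[OF X E, folded S_def]
  have S': "(- 1/2) \<cdot>\<^sub>m S \<in> carrier_mat r r" using S(1) by simp
  have "real_inner_mat (X * ((- 1/2) \<cdot>\<^sub>m S)) Z = 0"
  proof (rule real_inner_mat_normal[OF Z S'])
    fix a b assume ab: "a < r" "b < r"
    show "((- 1/2) \<cdot>\<^sub>m S) $$ (a, b) = cnj (((- 1/2) \<cdot>\<^sub>m S) $$ (b, a))"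
      using S(2)[OF ab] S(2)[OF ab(2,1)] S(1) ab by (simp del: index_mult_mat(1))
  qed
  then show ?thesis
    unfolding stiefel_proj_def S_def[symmetric] mult_smult_distrib[OF X S(1), symmetric]
      real_inner_mat_add_left[OF E mult_carrier_mat[OF X S'] tangent_space_skew(2)[OF Z]]
    by simp
qed

text \<open>A gradient is only paired with tangent vectors, and with these \<open>E\<close> and its projection have the same
  inner products.\<close>

lemma has_riem_grad_stiefel_proj:
  assumes X: "X \<in> stiefel r n" and E: "E \<in> carrier_mat n r"
    and deriv: "\<And>\<gamma> Z. stiefel_curve r n \<gamma> X Z \<Longrightarrow>
      ((\<lambda>t. h (\<gamma> t)) has_real_derivative real_inner_mat E Z) (at 0)"
  shows "has_riem_grad r n h X (stiefel_proj X E)"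
  unfolding has_riem_grad_def
proof (intro conjI allI impI stiefel_proj_tangent[OF X E])
  fix \<gamma> Z assume \<gamma>: "stiefel_curve r n \<gamma> X Z"
  then have Z: "Z \<in> tangent_space r n X" by (auto simp: tangent_space_def)
  show "((\<lambda>t. h (\<gamma> t)) has_real_derivative real_inner_mat (stiefel_proj X E) Z) (at 0)"
    unfolding stiefel_proj_inner[OF Z E] by (rule deriv[OF \<gamma>])
qed

text \<open>The derivative consists of the ambient derivative \<open>E'\<close>, a term with \<open>X'\<close> times the Hermitian part
  of \<open>X\<^sup>H E\<close>, and \<open>X\<close> times a Hermitian matrix. The last one is normal and drops out of the Riemannian
  Hessian.\<close>

lemma has_mat_deriv_stiefel_proj:
  assumes X: "has_mat_deriv n r X X' t" and E: "has_mat_deriv n r E E' t"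
  shows "has_mat_deriv n r (\<lambda>s. stiefel_proj (X s) (E s))
    (E' + (- 1/2) \<cdot>\<^sub>m (X' * (mat_adjoint (X t) * E t + mat_adjoint (E t) * X t)
      + X t * ((mat_adjoint X' * E t + mat_adjoint (X t) * E') + (mat_adjoint E' * X t + mat_adjoint (E t) * X')))) t"
  unfolding stiefel_proj_def
  by (rule has_mat_deriv_add[OF E has_mat_deriv_smult[OF has_mat_deriv_mult[OF X has_mat_deriv_add[OF
    has_mat_deriv_mult[OF has_mat_deriv_adjoint[OF X] E] has_mat_deriv_mult[OF has_mat_deriv_adjoint[OF E] X]]]]])

section \<open>Dimension\<close>

text \<open>The functionals show that the vectors \<open>e k\<close> are distinct and linearly independent. They also
  determine the coefficients of any vector; as they separate points, every vector is the linear
  combination with these coefficients.\<close>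

lemma dim_by_dual_functionals:
  fixes V :: "('a :: field, 'v, 'm) module_scheme" and e :: "'i \<Rightarrow> 'v" and \<phi> :: "'i \<Rightarrow> 'v \<Rightarrow> 'a"
  assumes V: "vectorspace class_ring V" and finite_I: "finite I"
    and e: "\<And>k. k \<in> I \<Longrightarrow> e k \<in> carrier V"
    and add: "\<And>k v w. k \<in> I \<Longrightarrow> v \<in> carrier V \<Longrightarrow> w \<in> carrier V \<Longrightarrow> \<phi> k (v \<oplus>\<^bsub>V\<^esub> w) = \<phi> k v + \<phi> k w"
    and smult: "\<And>k c v. k \<in> I \<Longrightarrow> v \<in> carrier V \<Longrightarrow> \<phi> k (c \<odot>\<^bsub>V\<^esub> v) = c * \<phi> k v"
    and dual: "\<And>k m. k \<in> I \<Longrightarrow> m \<in> I \<Longrightarrow> \<phi> k (e m) = (if k = m then 1 else 0)"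
    and sep: "\<And>v w. v \<in> carrier V \<Longrightarrow> w \<in> carrier V \<Longrightarrow> (\<And>k. k \<in> I \<Longrightarrow> \<phi> k v = \<phi> k w) \<Longrightarrow> v = w"
  shows "vectorspace.dim class_ring V = card I"
proof -
  interpret vectorspace class_ring V by (rule V)
  have zero: "\<phi> k \<zero>\<^bsub>V\<^esub> = 0" if "k \<in> I" for k
  proof -
    have "\<phi> k \<zero>\<^bsub>V\<^esub> = \<phi> k \<zero>\<^bsub>V\<^esub> + \<phi> k \<zero>\<^bsub>V\<^esub>"
      using add[OF that M.zero_closed M.zero_closed] by (simp only: M.l_zero M.zero_closed)
    then show ?thesis by (simp only: add_cancel_right_right)
  qed
  have \<phi>_lincomb: "\<phi> k (lincomb a A) = (\<Sum>v\<in>A. a v * \<phi> k v)"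
    if "k \<in> I" "finite A" "A \<subseteq> carrier V" for k a A
    using that(2,3)
  proof (induction A rule: finite_induct)
    case empty
    then show ?case by (simp add: lincomb_def zero[OF that(1)])
  next
    case (insert v A)
    have "lincomb a (insert v A) = a v \<odot>\<^bsub>V\<^esub> v \<oplus>\<^bsub>V\<^esub> lincomb a A"
      unfolding lincomb_def using insert by (intro finsum_insert) auto
    moreover have "lincomb a A \<in> carrier V" "a v \<odot>\<^bsub>V\<^esub> v \<in> carrier V"
      using insert by auto
    ultimately show ?case
      using insert by (simp add: add[OF that(1)] smult[OF that(1)])
  qed
  have inj: "inj_on e I"
  proof (rule inj_onI)
    fix k m assume "k \<in> I" "m \<in> I" "e k = e m"
    then show "k = m" using dual[of k k] dual[of k m] by (auto split: if_splits)
  qed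
  have finI: "finite (e ` I)" by (simp add: finite_I)
  have eI: "e ` I \<subseteq> carrier V" using e by auto
  have \<phi>_coeff: "\<phi> k (lincomb a (e ` I)) = a (e k)" if "k \<in> I" for k a
  proof -
    have "\<phi> k (lincomb a (e ` I)) = (\<Sum>m\<in>I. a (e m) * \<phi> k (e m))"
      using \<phi>_lincomb[OF that finI eI] by (simp add: sum.reindex[OF inj])
    also have "\<dots> = (\<Sum>m\<in>I. if k = m then a (e m) else 0)"
      using that by (intro sum.cong) (auto simp: dual)
    also have "\<dots> = a (e k)" using that finite_I by (simp add: sum.delta)
    finally show ?thesis .
  qed
  have "lin_indpt (e ` I)"
  proof (rule finite_lin_indpt2[OF finI eI])
    fix a assume "lincomb a (e ` I) = \<zero>\<^bsub>V\<^esub>"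
    then show "\<forall>v\<in>e ` I. a v = \<zero>\<^bsub>class_ring\<^esub>"
      using \<phi>_coeff[of _ a] zero by auto
  qed
  moreover have "span (e ` I) = carrier V"
  proof
    show "span (e ` I) \<subseteq> carrier V" by (rule span_is_subset2[OF eI])
    show "carrier V \<subseteq> span (e ` I)"
    proof
      fix v assume v: "v \<in> carrier V"
      define a where "a = (\<lambda>w. \<phi> (inv_into I e w) v)"
      have "lincomb a (e ` I) = v"
      proof (rule sep[OF _ v])
        show "lincomb a (e ` I) \<in> carrier V" using eI by (intro lincomb_closed) auto
        show "\<phi> k (lincomb a (e ` I)) = \<phi> k v" if "k \<in> I" for k
          using that by (simp add: \<phi>_coeff a_def inv_into_f_f[OF inj])
      qed
      then show "v \<in> span (e ` I)"
        unfolding span_def using finite_I by (auto intro!: exI[of _ a] exI[of _ "e ` I"])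
    qed
  qed
  ultimately have "basis (e ` I)" using eI by (simp add: basis_def)
  then show ?thesis
    using dim_basis[OF finI] by (simp add: card_image[OF inj])
qed

section \<open>Weighted sums of squared diagonal overlaps\<close>

lemma unitary_matD:
  assumes "unitary_mat n Q"
  shows "Q \<in> carrier_mat n n" "mat_adjoint Q \<in> carrier_mat n n"
    "A \<in> carrier_mat n m \<Longrightarrow> mat_adjoint Q * (Q * A) = A"
    "A \<in> carrier_mat n m \<Longrightarrow> Q * (mat_adjoint Q * A) = A"
proof -
  show Q: "Q \<in> carrier_mat n n" and QH: "mat_adjoint Q \<in> carrier_mat n n"
    using assms by (auto simp: unitary_mat_def)
  assume A: "A \<in> carrier_mat n m"
  show "mat_adjoint Q * (Q * A) = A" "Q * (mat_adjoint Q * A) = A"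
    using assms assoc_mult_mat[OF QH Q A] assoc_mult_mat[OF Q QH A] left_mult_one_mat[OF A]
    by (auto simp: unitary_mat_def)
qed

lemma trunc_id_carrier: "trunc_id n r \<in> carrier_mat n r"
  by (simp add: trunc_id_def)

lemma index_trunc_id_mult:
  fixes A :: "complex mat"
  assumes "A \<in> carrier_mat r m" "r \<le> n" "i < n" "j < m"
  shows "(trunc_id n r * A) $$ (i, j) = (if i < r then A $$ (i, j) else 0)"
proof -
  have "(trunc_id n r * A) $$ (i, j) = (\<Sum>l<r. if i = l then A $$ (l, j) else 0)"
    using assms unfolding index_mult_mat_sum[OF trunc_id_carrier assms(1,3,4)]
    by (intro sum.cong) (auto simp: trunc_id_def)
  then show ?thesis by simp
qed

lemma index_adjoint_trunc_id_mult:
  assumes "A \<in> carrier_mat n m" "r \<le> n" "i < r" "j < m"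
  shows "(mat_adjoint (trunc_id n r) * A) $$ (i, j) = A $$ (i, j)"
proof -
  have "(mat_adjoint (trunc_id n r) * A) $$ (i, j) = (\<Sum>l<n. if i = l then A $$ (l, j) else 0)"
    using assms unfolding index_adjoint_mult_sum[OF trunc_id_carrier assms(1,3,4)]
    by (intro sum.cong) (auto simp: trunc_id_def)
  then show ?thesis using assms by simp
qed

lemma stiefel_unitary_mult_trunc_id:
  assumes Q: "unitary_mat n Q" and "r \<le> n"
  shows "Q * trunc_id n r \<in> stiefel r n"
proof -
  let ?T = "trunc_id n r"
  have T: "mat_adjoint ?T \<in> carrier_mat r n"
    using trunc_id_carrier by (rule mat_adjoint_carrier)
  note QT = mult_carrier_mat[OF unitary_matD(1)[OF Q] trunc_id_carrier[of n r]]
  have "mat_adjoint (Q * ?T) * (Q * ?T) = mat_adjoint ?T * (mat_adjoint Q * (Q * ?T))"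
    unfolding mat_adjoint_mult[OF unitary_matD(1)[OF Q] trunc_id_carrier]
    by (rule assoc_mult_mat[OF T unitary_matD(2)[OF Q] QT])
  also have "mat_adjoint Q * (Q * ?T) = ?T" by (rule unitary_matD(3)[OF Q trunc_id_carrier])
  also have "mat_adjoint ?T * ?T = 1\<^sub>m r"
  proof (rule eq_matI)
    fix a b assume "a < dim_row (1\<^sub>m r :: complex mat)" "b < dim_col (1\<^sub>m r :: complex mat)"
    then have ab: "a < r" "b < r" by auto
    show "(mat_adjoint ?T * ?T) $$ (a, b) = 1\<^sub>m r $$ (a, b)"
      using ab \<open>r \<le> n\<close> unfolding index_adjoint_trunc_id_mult[OF trunc_id_carrier \<open>r \<le> n\<close> ab]
      by (simp add: trunc_id_def)
  qed (simp_all add: trunc_id_def)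
  finally show ?thesis using QT by (simp add: stiefel_def)
qed

text \<open>The function to which the restrictions of \<open>f\<close> reduce: \<open>(mat_adjoint Q * X) $$ (p, p)\<close> is the inner
  product of the columns number \<open>p\<close> of \<open>Q\<close> and \<open>X\<close>.\<close>

locale diagonal_overlap =
  fixes n r :: nat and Q :: "complex mat" and c :: "nat \<Rightarrow> real" and h :: "complex mat \<Rightarrow> real"
  assumes r_le_n: "r \<le> n" and Q: "unitary_mat n Q"
    and c_pos: "\<And>p. p < r \<Longrightarrow> 0 < c p"
    and h: "\<And>X. X \<in> stiefel r n \<Longrightarrow> h X = (\<Sum>p<r. c p * (cmod ((mat_adjoint Q * X) $$ (p, p)))\<^sup>2)"
begin

definition base :: "complex mat" where
  "base = Q * trunc_id n r"

definition weighted_diag :: "complex mat \<Rightarrow> complex mat" where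
  "weighted_diag Y = mat n r (\<lambda>(i, p). if i = p then 2 * complex_of_real (c p) * Y $$ (p, p) else 0)"

text \<open>The Euclidean gradient of the weighted sum of squares.\<close>

definition egrad :: "complex mat \<Rightarrow> complex mat" where
  "egrad X = Q * weighted_diag (mat_adjoint Q * X)"

text \<open>Minus the eigenvalue of the Hessian that belongs to the coordinate \<open>(i, p)\<close>, \<open>i \<noteq> p\<close>. It is
  symmetric on the upper block, so that the Hessian preserves the skew-Hermitian matrices there.\<close>

definition rate :: "nat \<Rightarrow> nat \<Rightarrow> real" where
  "rate i p = c p + (if i < r then c i else c p)"

definition hess_coord :: "complex mat \<Rightarrow> complex mat" where
  "hess_coord Y = mat n r (\<lambda>(i, p). if i = p then 0 else - complex_of_real (rate i p) * Y $$ (i, p))"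

definition hess :: "complex mat \<Rightarrow> complex mat" where
  "hess Z = Q * hess_coord (mat_adjoint Q * Z)"

lemma Qc: "Q \<in> carrier_mat n n" and QHc: "mat_adjoint Q \<in> carrier_mat n n"
  by (rule unitary_matD[OF Q])+

lemma coord_carrier: "Z \<in> carrier_mat n r \<Longrightarrow> mat_adjoint Q * Z \<in> carrier_mat n r"
  by (rule mult_carrier_mat[OF QHc])

lemma coord_inject:
  assumes "Y \<in> carrier_mat n r" "Z \<in> carrier_mat n r"
    and "\<And>i p. i < n \<Longrightarrow> p < r \<Longrightarrow> (mat_adjoint Q * Y) $$ (i, p) = (mat_adjoint Q * Z) $$ (i, p)"
  shows "Y = Z"
proof -
  note [simp] = carrier_matD[OF Qc] carrier_matD[OF assms(1)] carrier_matD[OF assms(2)]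
  have "mat_adjoint Q * Y = mat_adjoint Q * Z"
    by (rule eq_matI) (use assms(3) in \<open>simp_all del: index_mult_mat(1)\<close>)
  then have "Q * (mat_adjoint Q * Y) = Q * (mat_adjoint Q * Z)"
    by (rule arg_cong)
  then show ?thesis
    unfolding unitary_matD(4)[OF Q assms(1)] unitary_matD(4)[OF Q assms(2)] .
qed

lemma weighted_diag_carrier: "weighted_diag Y \<in> carrier_mat n r"
  by (simp add: weighted_diag_def)

lemma egrad_carrier: "egrad X \<in> carrier_mat n r"
  unfolding egrad_def by (rule mult_carrier_mat[OF Qc weighted_diag_carrier])

lemma hess_coord_carrier: "hess_coord Y \<in> carrier_mat n r"
  by (simp add: hess_coord_def)

lemma hess_carrier: "hess Z \<in> carrier_mat n r"
  unfolding hess_def by (rule mult_carrier_mat[OF Qc hess_coord_carrier])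

lemma coord_egrad: "mat_adjoint Q * egrad X = weighted_diag (mat_adjoint Q * X)"
  unfolding egrad_def by (rule unitary_matD(3)[OF Q weighted_diag_carrier])

lemma coord_hess: "mat_adjoint Q * hess Z = hess_coord (mat_adjoint Q * Z)"
  unfolding hess_def by (rule unitary_matD(3)[OF Q hess_coord_carrier])

lemma base_carrier: "base \<in> carrier_mat n r"
  unfolding base_def by (rule mult_carrier_mat[OF Qc trunc_id_carrier])

lemma coord_base: "mat_adjoint Q * base = trunc_id n r"
  unfolding base_def by (rule unitary_matD(3)[OF Q trunc_id_carrier])

lemma adjoint_base_mult:
  assumes A: "A \<in> carrier_mat n m" and ij: "i < r" "j < m"
  shows "(mat_adjoint base * A) $$ (i, j) = (mat_adjoint Q * A) $$ (i, j)"
proof -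
  have T: "mat_adjoint (trunc_id n r) \<in> carrier_mat r n"
    using trunc_id_carrier by (rule mat_adjoint_carrier)
  have "mat_adjoint base * A = mat_adjoint (trunc_id n r) * (mat_adjoint Q * A)"
    unfolding base_def mat_adjoint_mult[OF Qc trunc_id_carrier] by (rule assoc_mult_mat[OF T QHc A])
  then show ?thesis
    using index_adjoint_trunc_id_mult[OF mult_carrier_mat[OF QHc A] r_le_n ij] by simp
qed

lemma base_stiefel: "base \<in> stiefel r n"
  unfolding base_def by (rule stiefel_unitary_mult_trunc_id[OF Q r_le_n])

lemma tangent_space_base_iff:
  "Z \<in> tangent_space r n base \<longleftrightarrow> Z \<in> carrier_mat n r \<and>
    (\<forall>a<r. \<forall>b<r. (mat_adjoint Q * Z) $$ (a, b) + cnj ((mat_adjoint Q * Z) $$ (b, a)) = 0)"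
  unfolding tangent_space_iff[OF base_stiefel] by (auto simp: adjoint_base_mult simp del: index_mult_mat(1))

lemma real_inner_egrad:
  assumes Z: "Z \<in> carrier_mat n r"
  shows "real_inner_mat (egrad X) Z
    = (\<Sum>p<r. c p * (2 * Re (cnj ((mat_adjoint Q * X) $$ (p, p)) * (mat_adjoint Q * Z) $$ (p, p))))"
proof -
  let ?x = "\<lambda>p. (mat_adjoint Q * X) $$ (p, p)" and ?z = "\<lambda>p. (mat_adjoint Q * Z) $$ (p, p)"
  have "real_inner_mat (egrad X) Z = real_inner_mat (weighted_diag (mat_adjoint Q * X)) (mat_adjoint Q * Z)"
    unfolding egrad_def by (rule real_inner_mat_adjoint_shift[OF Qc weighted_diag_carrier Z])
  also have "\<dots> = (\<Sum>p<r. \<Sum>k<n. if k = p then c p * (2 * Re (cnj (?x p) * ?z p)) else 0)"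
    unfolding real_inner_mat_entries[OF weighted_diag_carrier coord_carrier[OF Z]]
    by (intro sum.cong refl) (simp add: weighted_diag_def algebra_simps del: index_mult_mat(1))
  also have "\<dots> = (\<Sum>p<r. c p * (2 * Re (cnj (?x p) * ?z p)))"
    using r_le_n by (intro sum.cong refl) (simp add: sum.delta del: index_mult_mat(1))
  finally show ?thesis .
qed

lemma h_has_derivative:
  assumes \<gamma>: "stiefel_curve r n \<gamma> X Z"
  shows "((\<lambda>t. h (\<gamma> t)) has_real_derivative real_inner_mat (egrad X) Z) (at 0)"
proof -
  have st: "\<gamma> t \<in> stiefel r n" and X: "\<gamma> 0 = X" and d: "has_mat_deriv n r \<gamma> Z 0" for t
    using \<gamma> by (auto simp: stiefel_curve_def)
  have "((\<lambda>t. \<Sum>p<r. c p * (cmod ((mat_adjoint Q * \<gamma> t) $$ (p, p)))\<^sup>2) has_real_derivative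
      (\<Sum>p<r. c p * (2 * Re (cnj ((mat_adjoint Q * \<gamma> 0) $$ (p, p)) * (mat_adjoint Q * Z) $$ (p, p))))) (at 0)"
    using r_le_n by (intro DERIV_sum DERIV_cmult has_real_derivative_cmod_power2
        has_mat_derivD(3)[OF has_mat_deriv_const_mult[OF QHc d]]) auto
  then show ?thesis
    unfolding X real_inner_egrad[OF has_mat_derivD(2)[OF d]] by (simp only: h[OF st])
qed

lemma has_riem_grad_egrad:
  "X \<in> stiefel r n \<Longrightarrow> has_riem_grad r n h X (stiefel_proj X (egrad X))"
  by (rule has_riem_grad_stiefel_proj[OF _ egrad_carrier h_has_derivative])

lemma has_mat_deriv_egrad:
  assumes "has_mat_deriv n r \<gamma> Z t"
  shows "has_mat_deriv n r (\<lambda>s. egrad (\<gamma> s)) (egrad Z) t"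
  unfolding egrad_def
proof (rule has_mat_deriv_const_mult[OF Qc])
  note d = has_mat_derivD(3)[OF has_mat_deriv_const_mult[OF QHc assms]]
  have "((\<lambda>s. weighted_diag (mat_adjoint Q * \<gamma> s) $$ (i, p)) has_vector_derivative
      weighted_diag (mat_adjoint Q * Z) $$ (i, p)) (at t)" if ip: "i < n" "p < r" for i p
  proof (cases "i = p")
    case True
    then show ?thesis
      using ip d[of p p] by (simp add: weighted_diag_def has_vector_derivative_mult_right del: index_mult_mat(1))
  next
    case False
    then show ?thesis using ip by (simp add: weighted_diag_def)
  qed
  then show "has_mat_deriv n r (\<lambda>s. weighted_diag (mat_adjoint Q * \<gamma> s)) (weighted_diag (mat_adjoint Q * Z)) t"
    by (simp add: has_mat_deriv_def weighted_diag_carrier)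
qed

lemma hermitian_part_egrad_base:
  assumes "a < r" "b < r"
  shows "(mat_adjoint base * egrad base + mat_adjoint (egrad base) * base) $$ (a, b)
    = (if a = b then 4 * complex_of_real (c b) else 0)"
  using assms r_le_n
  unfolding stiefel_proj_hermitian_part(2)[OF base_carrier egrad_carrier assms]
  by (simp add: adjoint_base_mult[OF egrad_carrier] coord_egrad coord_base del: index_mult_mat(1))
    (simp add: weighted_diag_def trunc_id_def)

lemma coord_mult:
  assumes "A \<in> carrier_mat n r" "S \<in> carrier_mat r m"
  shows "mat_adjoint Q * (A * S) = (mat_adjoint Q * A) * S"
  by (rule assoc_mult_mat[OF QHc assms, symmetric])

lemma has_riem_grad_base: "has_riem_grad r n h base (0\<^sub>m n r)"
proof -
  let ?S = "mat_adjoint base * egrad base + mat_adjoint (egrad base) * base"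
  have S: "?S \<in> carrier_mat r r" by (rule stiefel_proj_hermitian_part(1)[OF base_carrier egrad_carrier])
  note BS = mult_carrier_mat[OF base_carrier S]
  note TS = mult_carrier_mat[OF trunc_id_carrier[of n r] S]
  have "stiefel_proj base (egrad base) = 0\<^sub>m n r"
  proof (rule coord_inject[OF stiefel_proj_carrier[OF base_carrier egrad_carrier]])
    fix i p assume ip: "i < n" "p < r"
    have "mat_adjoint Q * stiefel_proj base (egrad base)
        = weighted_diag (trunc_id n r) + (- 1/2) \<cdot>\<^sub>m (trunc_id n r * ?S)"
      unfolding stiefel_proj_def mult_add_distrib_mat[OF QHc egrad_carrier smult_carrier_mat[OF BS]]
        mult_smult_distrib[OF QHc BS] coord_mult[OF base_carrier S] coord_egrad coord_base ..
    moreover have "(trunc_id n r * ?S) $$ (i, p) = trunc_id n r $$ (i, p) * (4 * complex_of_real (c p))"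
      by (rule index_mult_diagonal[OF trunc_id_carrier S hermitian_part_egrad_base ip])
    ultimately have "(mat_adjoint Q * stiefel_proj base (egrad base)) $$ (i, p) = 0"
      using ip r_le_n carrier_matD[OF TS] by (simp del: index_mult_mat) (simp add: weighted_diag_def trunc_id_def)
    then show "(mat_adjoint Q * stiefel_proj base (egrad base)) $$ (i, p) = (mat_adjoint Q * 0\<^sub>m n r) $$ (i, p)"
      using ip right_mult_zero_mat[OF QHc, of r] by (simp del: index_mult_mat(1))
  qed simp
  then show ?thesis using has_riem_grad_egrad[OF base_stiefel] by simp
qed

section \<open>The Hessian at the base point\<close>

lemma hess_tangent:
  assumes "Z \<in> tangent_space r n base"
  shows "hess Z \<in> tangent_space r n base"
  unfolding tangent_space_base_iff coord_hess
proof (intro conjI allI impI hess_carrier)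
  fix a b assume ab: "a < r" "b < r"
  have "(mat_adjoint Q * Z) $$ (a, b) = - cnj ((mat_adjoint Q * Z) $$ (b, a))"
    using assms ab by (simp add: tangent_space_base_iff eq_neg_iff_add_eq_0 del: index_mult_mat(1))
  then show "hess_coord (mat_adjoint Q * Z) $$ (a, b) + cnj (hess_coord (mat_adjoint Q * Z) $$ (b, a)) = 0"
    using ab r_le_n by (simp add: hess_coord_def rate_def algebra_simps del: index_mult_mat(1))
qed

lemma hess_add:
  assumes "Y \<in> carrier_mat n r" "Z \<in> carrier_mat n r"
  shows "hess (Y + Z) = hess Y + hess Z"
proof -
  have "hess_coord (mat_adjoint Q * (Y + Z)) = hess_coord (mat_adjoint Q * Y) + hess_coord (mat_adjoint Q * Z)"
    unfolding mult_add_distrib_mat[OF QHc assms]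
    using carrier_matD[OF Qc] carrier_matD[OF assms(1)] carrier_matD[OF assms(2)]
    by (intro eq_matI) (auto simp: hess_coord_def algebra_simps simp del: index_mult_mat(1))
  then show ?thesis
    unfolding hess_def using mult_add_distrib_mat[OF Qc hess_coord_carrier hess_coord_carrier] by simp
qed

lemma hess_smult:
  assumes "Z \<in> carrier_mat n r"
  shows "hess (s \<cdot>\<^sub>m Z) = s \<cdot>\<^sub>m hess Z"
proof -
  have "hess_coord (mat_adjoint Q * (s \<cdot>\<^sub>m Z)) = s \<cdot>\<^sub>m hess_coord (mat_adjoint Q * Z)"
    unfolding mult_smult_distrib[OF QHc assms]
    using carrier_matD[OF Qc] carrier_matD[OF assms]
    by (intro eq_matI) (auto simp: hess_coord_def algebra_simps simp del: index_mult_mat(1))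
  then show ?thesis
    unfolding hess_def using mult_smult_distrib[OF Qc hess_coord_carrier] by simp
qed

lemma linear_map_hess: "linear_map class_ring (tangent_module r n base) (tangent_module r n base) hess"
proof -
  note V = vectorspace_tangent_module[OF base_stiefel]
  have "hess \<in> LinearCombinations.module_hom class_ring (tangent_module r n base) (tangent_module r n base)"
    using hess_tangent hess_add[OF tangent_space_skew(2) tangent_space_skew(2)] hess_smult[OF tangent_space_skew(2)]
    by (auto simp: LinearCombinations.module_hom_def tangent_module_def)
  with V show ?thesis
    by (simp add: linear_map_def mod_hom_def mod_hom_axioms_def vectorspace_def)
qed

text \<open>The matrix that is projected is the derivative of the Riemannian gradient along \<open>Z\<close>. It differs
  from \<open>hess Z\<close> by \<open>base * M\<close> with a Hermitian \<open>M\<close>, hence by a normal vector.\<close>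

lemma is_tangent_proj_hess:
  assumes Z: "Z \<in> tangent_space r n base"
  defines "R \<equiv> (mat_adjoint Z * egrad base + mat_adjoint base * egrad Z)
      + (mat_adjoint (egrad Z) * base + mat_adjoint (egrad base) * Z)"
    and "S \<equiv> mat_adjoint base * egrad base + mat_adjoint (egrad base) * base"
  shows "is_tangent_proj r n base (egrad Z + (- 1/2) \<cdot>\<^sub>m (Z * S + base * R)) (hess Z)"
proof -
  note Zc = tangent_space_skew(2)[OF Z]
  let ?Y = "mat_adjoint Q * Z"
  have S: "S \<in> carrier_mat r r"
    unfolding S_def by (rule stiefel_proj_hermitian_part(1)[OF base_carrier egrad_carrier])
  have R: "R \<in> carrier_mat r r"
    unfolding R_def using Zc base_carrier egrad_carrier
    by (intro add_carrier_mat mult_carrier_mat[of _ r n] mat_adjoint_carrier)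
  have R_herm: "R $$ (a, b) = cnj (R $$ (b, a))" if ab: "a < r" "b < r" for a b
  proof -
    note [simp] = carrier_matD[OF Zc] carrier_matD[OF base_carrier] carrier_matD[OF egrad_carrier]
    have e: "R $$ (a, b) = ((mat_adjoint Z * egrad base) $$ (a, b) + (mat_adjoint base * egrad Z) $$ (a, b))
        + ((mat_adjoint (egrad Z) * base) $$ (a, b) + (mat_adjoint (egrad base) * Z) $$ (a, b))"
      if "a < r" "b < r" for a b
      using that by (simp add: R_def del: index_mult_mat(1))
    show ?thesis
      unfolding e[OF ab] e[OF ab(2,1)]
        index_adjoint_mult_cnj[OF egrad_carrier base_carrier ab] index_adjoint_mult_cnj[OF egrad_carrier base_carrier ab(2,1)]
        index_adjoint_mult_cnj[OF egrad_carrier Zc ab] index_adjoint_mult_cnj[OF egrad_carrier Zc ab(2,1)]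
      by (simp del: index_mult_mat(1))
  qed
  \<comment> \<open>On the upper block, the ambient derivative multiplies \<open>?Y\<close> by \<open>- 2 c\<^sub>b\<close> off the diagonal, which is
    \<open>- (c\<^sub>a + c\<^sub>b) + (c\<^sub>a - c\<^sub>b)\<close>. As \<open>?Y\<close> is skew-Hermitian there, the second summand gives a Hermitian
    matrix.\<close>
  define M where "M = mat r r (\<lambda>(a, b). complex_of_real (c a - c b) * ?Y $$ (a, b) - R $$ (a, b) / 2)"
  have M: "M \<in> carrier_mat r r" by (simp add: M_def)
  have M_herm: "M $$ (a, b) = cnj (M $$ (b, a))" if ab: "a < r" "b < r" for a b
  proof -
    have "?Y $$ (a, b) = - cnj (?Y $$ (b, a))"
      using Z ab by (simp add: tangent_space_base_iff eq_neg_iff_add_eq_0 del: index_mult_mat(1))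
    then show ?thesis
      using ab R_herm[OF ab] by (simp add: M_def algebra_simps del: index_mult_mat(1))
  qed
  let ?W = "egrad Z + (- 1/2) \<cdot>\<^sub>m (Z * S + base * R)"
  note ZS = mult_carrier_mat[OF Zc S] and BR = mult_carrier_mat[OF base_carrier R]
    and BM = mult_carrier_mat[OF base_carrier M]
  have W: "?W = hess Z + base * M"
  proof (rule coord_inject)
    show "?W \<in> carrier_mat n r"
      by (intro add_carrier_mat smult_carrier_mat ZS BR)
    show "hess Z + base * M \<in> carrier_mat n r"
      by (intro add_carrier_mat BM)
    fix i p assume ip: "i < n" "p < r"
    have "mat_adjoint Q * ?W = weighted_diag ?Y + (- 1/2) \<cdot>\<^sub>m (?Y * S + trunc_id n r * R)"
      unfolding mult_add_distrib_mat[OF QHc egrad_carrier smult_carrier_mat[OF add_carrier_mat[OF BR]]]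
        mult_smult_distrib[OF QHc add_carrier_mat[OF BR]] mult_add_distrib_mat[OF QHc ZS BR]
        coord_mult[OF Zc S] coord_mult[OF base_carrier R] coord_egrad coord_base ..
    then have "(mat_adjoint Q * ?W) $$ (i, p)
        = weighted_diag ?Y $$ (i, p) - ((?Y * S) $$ (i, p) + (trunc_id n r * R) $$ (i, p)) / 2"
      using ip carrier_matD[OF Zc] carrier_matD[OF Qc] carrier_matD[OF S] carrier_matD[OF R]
        carrier_matD[OF trunc_id_carrier[of n r]] by (simp del: index_mult_mat(1))
    also have "(?Y * S) $$ (i, p) = ?Y $$ (i, p) * (4 * complex_of_real (c p))"
      unfolding S_def by (rule index_mult_diagonal[OF coord_carrier[OF Zc] S[unfolded S_def] hermitian_part_egrad_base ip])
    also have "(trunc_id n r * R) $$ (i, p) = (if i < r then R $$ (i, p) else 0)"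
      by (rule index_trunc_id_mult[OF R r_le_n ip])
    also have "weighted_diag ?Y $$ (i, p) - (?Y $$ (i, p) * (4 * complex_of_real (c p)) + (if i < r then R $$ (i, p) else 0)) / 2
        = hess_coord ?Y $$ (i, p) + (if i < r then M $$ (i, p) else 0)"
      using ip by (auto simp: weighted_diag_def hess_coord_def M_def rate_def field_simps simp del: index_mult_mat(1))
    also have "\<dots> = (hess_coord ?Y + trunc_id n r * M) $$ (i, p)"
      using ip index_trunc_id_mult[OF M r_le_n ip] carrier_matD[OF M] carrier_matD[OF trunc_id_carrier[of n r]]
      by (simp del: index_mult_mat(1))
    also have "hess_coord ?Y + trunc_id n r * M = mat_adjoint Q * (hess Z + base * M)"
      unfolding mult_add_distrib_mat[OF QHc hess_carrier BM] coord_mult[OF base_carrier M] coord_hess coord_base ..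
    finally show "(mat_adjoint Q * ?W) $$ (i, p) = (mat_adjoint Q * (hess Z + base * M)) $$ (i, p)" .
  qed
  show ?thesis
    unfolding is_tangent_proj_def W
    using hess_tangent[OF Z] real_inner_mat_add_left[OF hess_carrier BM tangent_space_skew(2)]
      real_inner_mat_normal[OF _ M M_herm] by simp
qed

lemma has_riem_hess_base: "has_riem_hess r n h base hess"
  unfolding has_riem_hess_def
proof (intro conjI linear_map_hess exI[of _ "\<lambda>X. stiefel_proj X (egrad X)"] ballI allI impI has_riem_grad_egrad)
  fix \<gamma> Z assume \<gamma>: "stiefel_curve r n \<gamma> base Z"
  then have Z: "Z \<in> tangent_space r n base" and d: "has_mat_deriv n r \<gamma> Z 0" and 0: "\<gamma> 0 = base"
    by (auto simp: tangent_space_def stiefel_curve_def)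
  show "\<exists>W. has_mat_deriv n r (\<lambda>t. stiefel_proj (\<gamma> t) (egrad (\<gamma> t))) W 0 \<and> is_tangent_proj r n base W (hess Z)"
    using has_mat_deriv_stiefel_proj[OF d has_mat_deriv_egrad[OF d], unfolded 0] is_tangent_proj_hess[OF Z] by blast
qed

section \<open>Scale invariance\<close>

lemma scale_invariant_h: "scale_invariant r n h"
  unfolding scale_invariant_def
proof (intro ballI allI impI)
  fix X R assume X: "X \<in> stiefel r n" and "unitary_mat r R \<and> diagonal_mat R"
  then have R: "R \<in> carrier_mat r r" "mat_adjoint R * R = 1\<^sub>m r" and diag: "diagonal_mat R"
    by (auto simp: unitary_mat_def)
  note Xc = stiefelD(1)[OF X] and XR = mult_carrier_mat[OF stiefelD(1)[OF X] R(1)]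
  have R_diag: "R $$ (a, b) = (if a = b then R $$ (b, b) else 0)" if "a < r" "b < r" for a b
    using diag that R(1) by (auto simp: diagonal_mat_def)
  have RH: "mat_adjoint R \<in> carrier_mat r r" and XH: "mat_adjoint X \<in> carrier_mat r n"
    using R(1) Xc by auto
  have "mat_adjoint (X * R) * (X * R) = mat_adjoint R * (mat_adjoint X * (X * R))"
    unfolding mat_adjoint_mult[OF Xc R(1)] by (rule assoc_mult_mat[OF RH XH XR])
  also have "mat_adjoint X * (X * R) = R"
    using assoc_mult_mat[OF XH Xc R(1)] stiefelD(2)[OF X] left_mult_one_mat[OF R(1)] by simp
  finally have XR_stiefel: "X * R \<in> stiefel r n"
    using XR R(2) by (simp add: stiefel_def)
  have cmod_R: "cmod (R $$ (p, p)) = 1" if p: "p < r" for p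
  proof -
    have "(mat_adjoint R * R) $$ (p, p) = cnj (R $$ (p, p)) * R $$ (p, p)"
      using p RH R(1) by (subst index_mult_diagonal[OF RH R(1) R_diag]) auto
    then have "R $$ (p, p) * cnj (R $$ (p, p)) = 1" using R(2) p by (simp add: mult.commute)
    then have "complex_of_real ((cmod (R $$ (p, p)))\<^sup>2) = 1" unfolding complex_norm_square .
    then have "(cmod (R $$ (p, p)))\<^sup>2 = 1" by (simp only: of_real_eq_1_iff)
    then show ?thesis by (simp add: power2_eq_1_iff) (smt (verit) norm_ge_zero)
  qed
  have "(mat_adjoint Q * (X * R)) $$ (p, p) = (mat_adjoint Q * X) $$ (p, p) * R $$ (p, p)" if "p < r" for p
    unfolding coord_mult[OF Xc R(1)] using that r_le_n
    by (intro index_mult_diagonal[OF coord_carrier[OF Xc] R(1) R_diag]) auto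
  then have "cmod ((mat_adjoint Q * (X * R)) $$ (p, p)) = cmod ((mat_adjoint Q * X) $$ (p, p))" if "p < r" for p
    using that cmod_R[OF that] by (simp add: norm_mult del: index_mult_mat(1))
  then show "h (X * R) = h X"
    unfolding h[OF XR_stiefel] h[OF X] by (intro sum.cong) (auto simp del: index_mult_mat(1))
qed

section \<open>The rank of the Hessian\<close>

text \<open>The free real coordinates of the range of the Hessian: the real and the imaginary parts of the
  entries below the diagonal. The flag \<open>True\<close> stands for the real part.\<close>

definition off_diag_index :: "(nat \<times> nat \<times> bool) set" where
  "off_diag_index = (SIGMA p:{..<r}. {p<..<n} \<times> UNIV)"

text \<open>The tangent coordinates with \<open>1\<close> or \<open>\<i>\<close> at \<open>(i, p)\<close>, completed skew-Hermitian; if \<open>i \<ge> r\<close>, the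
  position \<open>(p, i)\<close> lies outside of the matrix and nothing is completed.\<close>

definition off_diag_unit :: "nat \<times> nat \<times> bool \<Rightarrow> complex mat" where
  "off_diag_unit = (\<lambda>(p, i, b). let z = (if b then 1 else \<i>) in
     mat n r (\<lambda>(k, q). if k = i \<and> q = p then z else if k = p \<and> q = i then - cnj z else 0))"

definition off_diag_coord :: "nat \<times> nat \<times> bool \<Rightarrow> complex mat \<Rightarrow> real" where
  "off_diag_coord = (\<lambda>(p, i, b) Z. (if b then Re else Im) ((mat_adjoint Q * Z) $$ (i, p)))"

lemma off_diag_unit_carrier: "off_diag_unit k \<in> carrier_mat n r"
  by (simp add: off_diag_unit_def Let_def split: prod.split)

text \<open>The vector is an eigenvector of the Hessian with the eigenvalue \<open>- rate i p\<close>. This is where the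
  weights \<open>c\<close> have to be positive.\<close>

lemma off_diag_unit_in_range:
  assumes k: "k \<in> off_diag_index"
  shows "Q * off_diag_unit k \<in> hess ` tangent_space r n base"
proof -
  obtain p i b where k_eq: "k = (p, i, b)" and pi: "p < r" "p < i" "i < n"
    using k by (auto simp: off_diag_index_def)
  define s where "s = - 1 / rate i p"
  let ?B = "off_diag_unit k"
  note B = off_diag_unit_carrier[of k] and QB = mult_carrier_mat[OF Qc off_diag_unit_carrier[of k]]
  have coord: "mat_adjoint Q * (Q * ?B) = ?B" by (rule unitary_matD(3)[OF Q B])
  have "rate i p > 0" using pi c_pos[of p] c_pos[of i] by (auto simp: rate_def)
  have "hess_coord ?B = complex_of_real (- rate i p) \<cdot>\<^sub>m ?B"
  proof (rule eq_matI)
    fix k' q assume "k' < dim_row (complex_of_real (- rate i p) \<cdot>\<^sub>m ?B)"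
      "q < dim_col (complex_of_real (- rate i p) \<cdot>\<^sub>m ?B)"
    then show "hess_coord ?B $$ (k', q) = (complex_of_real (- rate i p) \<cdot>\<^sub>m ?B) $$ (k', q)"
      using pi carrier_matD[OF B]
      by (auto simp: hess_coord_def off_diag_unit_def k_eq Let_def rate_def)
  qed (use B hess_coord_carrier[of ?B] in auto)
  then have "hess (Q * ?B) = complex_of_real (- rate i p) \<cdot>\<^sub>m (Q * ?B)"
    unfolding hess_def coord using mult_smult_distrib[OF Qc B] by simp
  then have "hess (complex_of_real s \<cdot>\<^sub>m (Q * ?B)) = (complex_of_real s * complex_of_real (- rate i p)) \<cdot>\<^sub>m (Q * ?B)"
    unfolding hess_smult[OF QB] by (intro eq_matI) auto
  also have "complex_of_real s * complex_of_real (- rate i p) = 1"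
    using \<open>rate i p > 0\<close> by (simp add: s_def)
  also have "1 \<cdot>\<^sub>m (Q * ?B) = Q * ?B" by (rule eq_matI) simp_all
  finally have "hess (complex_of_real s \<cdot>\<^sub>m (Q * ?B)) = Q * ?B" .
  moreover have "Q * ?B \<in> tangent_space r n base"
    unfolding tangent_space_base_iff coord
  proof (intro conjI allI impI QB)
    show "?B $$ (a, b') + cnj (?B $$ (b', a)) = 0" if "a < r" "b' < r" for a b'
      using that pi r_le_n by (auto simp: off_diag_unit_def k_eq Let_def)
  qed
  then have "complex_of_real s \<cdot>\<^sub>m (Q * ?B) \<in> tangent_space r n base"
    by (rule tangent_space_smult)
  ultimately show ?thesis by (metis image_eqI)
qed

lemma off_diag_coord_dual:
  assumes "k \<in> off_diag_index" "m \<in> off_diag_index"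
  shows "off_diag_coord k (Q * off_diag_unit m) = (if k = m then 1 else 0)"
  using assms unitary_matD(3)[OF Q off_diag_unit_carrier[of m]]
  by (auto simp: off_diag_coord_def off_diag_index_def off_diag_unit_def Let_def
      simp del: index_mult_mat(1) split: if_splits)

text \<open>An element of the range has zeros on the diagonal of its coordinates, and the entries above the
  diagonal are determined by those below it.\<close>

lemma range_hess_eqI:
  assumes Y: "Y \<in> hess ` tangent_space r n base" and Z: "Z \<in> hess ` tangent_space r n base"
    and eq: "\<And>k. k \<in> off_diag_index \<Longrightarrow> off_diag_coord k Y = off_diag_coord k Z"
  shows "Y = Z"
proof (rule coord_inject)
  have T: "Y \<in> tangent_space r n base" "Z \<in> tangent_space r n base"
    using Y Z hess_tangent by auto
  show "Y \<in> carrier_mat n r" "Z \<in> carrier_mat n r"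
    using T by (auto dest: tangent_space_skew(2))
  have below: "(mat_adjoint Q * Y) $$ (i, p) = (mat_adjoint Q * Z) $$ (i, p)" if "p < r" "p < i" "i < n" for i p
    using eq[of "(p, i, True)"] eq[of "(p, i, False)"] that
    by (intro complex_eqI) (auto simp: off_diag_coord_def off_diag_index_def simp del: index_mult_mat(1))
  have diag: "(mat_adjoint Q * W) $$ (p, p) = 0" if "W \<in> hess ` tangent_space r n base" "p < r" for W p
    using that r_le_n by (auto simp: coord_hess simp del: index_mult_mat(1)) (simp add: hess_coord_def)
  have skew: "(mat_adjoint Q * W) $$ (a, b) = - cnj ((mat_adjoint Q * W) $$ (b, a))"
    if "W \<in> tangent_space r n base" "a < r" "b < r" for W a b
    using that by (simp add: tangent_space_base_iff eq_neg_iff_add_eq_0 del: index_mult_mat(1))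
  fix i p assume ip: "i < n" "p < r"
  consider "p < i" | "i = p" | "i < p" by linarith
  then show "(mat_adjoint Q * Y) $$ (i, p) = (mat_adjoint Q * Z) $$ (i, p)"
  proof cases
    case 1
    then show ?thesis using below ip by blast
  next
    case 2
    then show ?thesis using diag[OF Y] diag[OF Z] ip by (simp del: index_mult_mat(1))
  next
    case 3
    then have "i < r" "p < n" using ip r_le_n by auto
    then show ?thesis
      using skew[OF T(1), of i p] skew[OF T(2), of i p] below[of i p] 3 ip by (simp del: index_mult_mat(1))
  qed
qed

lemma card_off_diag_index: "int (card off_diag_index) = 2 * int n * int r - (int r)\<^sup>2 - int r"
proof -
  have "card off_diag_index = (\<Sum>p<r. card ({p<..<n} \<times> (UNIV :: bool set)))"
    unfolding off_diag_index_def by (rule card_SigmaI) auto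
  also have "\<dots> = (\<Sum>p<r. 2 * (n - Suc p))"
    by (intro sum.cong refl) (simp add: card_cartesian_product)
  finally have "card off_diag_index = (\<Sum>p<r. 2 * (n - Suc p))" .
  moreover have "int (\<Sum>p<m. 2 * (n - Suc p)) = 2 * int n * int m - (int m)\<^sup>2 - int m" if "m \<le> n" for m
    using that by (induction m) (auto simp: power2_eq_square algebra_simps of_nat_diff)
  ultimately show ?thesis using r_le_n by simp
qed

lemma real_rank_hess: "real_rank r n base hess = card off_diag_index"
proof -
  interpret hess: linear_map class_ring "tangent_module r n base" "tangent_module r n base" hess
    by (rule linear_map_hess)
  have carr: "carrier (tangent_module r n base) = tangent_space r n base"
    by (simp add: tangent_module_def)
  let ?V = "(tangent_module r n base)\<lparr>carrier := hess ` tangent_space r n base\<rparr>"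
  have V: "vectorspace class_ring ?V"
    using vectorspace.subspace_is_vs[OF vectorspace_tangent_module[OF base_stiefel] hess.imT_is_subspace] by (simp add: hess.im_def carr)
  have sub: "W \<in> carrier_mat n r" if "W \<in> hess ` tangent_space r n base" for W
    using that hess_carrier by auto
  note [simp] = carrier_matD[OF Qc]
  show ?thesis
    unfolding real_rank_def
  proof (rule dim_by_dual_functionals[OF V, where e = "\<lambda>k. Q * off_diag_unit k" and \<phi> = off_diag_coord])
    show "finite off_diag_index" by (simp add: off_diag_index_def)
    show "Q * off_diag_unit k \<in> carrier ?V" if "k \<in> off_diag_index" for k
      using off_diag_unit_in_range[OF that] by simp
    show "off_diag_coord k (Q * off_diag_unit m) = (if k = m then 1 else 0)"
      if "k \<in> off_diag_index" "m \<in> off_diag_index" for k m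
      by (rule off_diag_coord_dual[OF that])
    show "Y = Z" if "Y \<in> carrier ?V" "Z \<in> carrier ?V"
      "\<And>k. k \<in> off_diag_index \<Longrightarrow> off_diag_coord k Y = off_diag_coord k Z" for Y Z
      using that by (intro range_hess_eqI) simp_all
    show "off_diag_coord k (Y \<oplus>\<^bsub>?V\<^esub> Z) = off_diag_coord k Y + off_diag_coord k Z"
      if "k \<in> off_diag_index" "Y \<in> carrier ?V" "Z \<in> carrier ?V" for k Y Z
    proof -
      have c: "Y \<in> carrier_mat n r" "Z \<in> carrier_mat n r" using that sub by simp_all
      have "Y \<oplus>\<^bsub>?V\<^esub> Z = Y + Z" by (simp add: tangent_module_def)
      then show ?thesis
        using that(1) mult_add_distrib_mat[OF QHc c] carrier_matD[OF c(1)] carrier_matD[OF c(2)]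
        by (auto simp: off_diag_coord_def off_diag_index_def simp del: index_mult_mat(1))
    qed
    show "off_diag_coord k (s \<odot>\<^bsub>?V\<^esub> Z) = s * off_diag_coord k Z"
      if "k \<in> off_diag_index" "Z \<in> carrier ?V" for k s Z
    proof -
      have c: "Z \<in> carrier_mat n r" using that sub by simp
      have "s \<odot>\<^bsub>?V\<^esub> Z = complex_of_real s \<cdot>\<^sub>m Z" by (simp add: tangent_module_def)
      then show ?thesis
        using that(1) mult_smult_distrib[OF QHc c] carrier_matD[OF c]
        by (auto simp: off_diag_coord_def off_diag_index_def simp del: index_mult_mat(1))
    qed
  qed
qed

lemma scale_semi_nondegenerate_base: "scale_semi_nondegenerate r n h base"
  unfolding scale_semi_nondegenerate_def
  using base_stiefel scale_invariant_h has_riem_grad_base has_riem_hess_base real_rank_hess card_off_diag_index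
  by auto

end

section \<open>Mode products of sums of rank-one tensors\<close>

text \<open>Mode products act on each rank-one summand separately and, within it, on one vector at a time.
  After \<open>e\<close> of the products the first \<open>e\<close> vectors have been transformed; in these modes \<open>p\<close> may be
  arbitrary, since the given tensor is read only at the summation indices.\<close>

lemma fold_mode_prod_sum_rank_one:
  assumes A: "\<And>p. length p = d \<Longrightarrow> (\<And>j. j < d \<Longrightarrow> p ! j < dim_col (X j)) \<Longrightarrow>
      A p = (\<Sum>m\<in>M. w m * (\<Prod>j<d. v j m (p ! j)))"
    and "e \<le> d" "length p = d" "\<And>j. e \<le> j \<Longrightarrow> j < d \<Longrightarrow> p ! j < dim_col (X j)"
  shows "fold (\<lambda>i B. mode_prod B i (X i)) [0..<e] A p = (\<Sum>m\<in>M. w m * (\<Prod>j<d.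
    if j < e then \<Sum>k<dim_col (X j). X j $$ (p ! j, k) * v j m k else v j m (p ! j)))"
  using assms(2-)
proof (induction e arbitrary: p)
  case 0
  then show ?case using A[of p] by simp
next
  case (Suc e)
  let ?g = "\<lambda>m j. if j < Suc e then \<Sum>k<dim_col (X j). X j $$ (p ! j, k) * v j m k else v j m (p ! j)"
  let ?R = "\<lambda>m. \<Prod>j\<in>{..<d} - {e}. ?g m j"
  have e: "e < d" using Suc.prems by simp
  have IH: "fold (\<lambda>i B. mode_prod B i (X i)) [0..<e] A (p[e := k]) = (\<Sum>m\<in>M. w m * (v e m k * ?R m))"
    if "k < dim_col (X e)" for k
  proof -
    have "(\<Prod>j<d. if j < e then \<Sum>k'<dim_col (X j). X j $$ (p[e := k] ! j, k') * v j m k' else v j m (p[e := k] ! j))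
        = v e m k * ?R m" for m
    proof -
      have "(if j < e then \<Sum>k'<dim_col (X j). X j $$ (p[e := k] ! j, k') * v j m k' else v j m (p[e := k] ! j)) = ?g m j"
        if "j \<in> {..<d} - {e}" for j
      proof -
        have "e \<noteq> j" "j < Suc e \<longleftrightarrow> j < e" using that by auto
        then show ?thesis by simp
      qed
      then show ?thesis
        using e Suc.prems by (subst prod.remove[of _ e]) (auto intro!: arg_cong2[where f = "(*)"] prod.cong)
    qed
    moreover have "p[e := k] ! j < dim_col (X j)" if "e \<le> j" "j < d" for j
      using that Suc.prems \<open>k < dim_col (X e)\<close> by (cases "j = e") auto
    ultimately show ?thesis
      using Suc.IH[of "p[e := k]"] Suc.prems by simp
  qed
  have "fold (\<lambda>i B. mode_prod B i (X i)) [0..<Suc e] A p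
      = (\<Sum>k<dim_col (X e). (\<Sum>m\<in>M. w m * (v e m k * ?R m)) * X e $$ (p ! e, k))"
    (is "_ = ?S")
  proof -
    have "fold (\<lambda>i B. mode_prod B i (X i)) [0..<Suc e] A p
        = mode_prod (fold (\<lambda>i B. mode_prod B i (X i)) [0..<e] A) e (X e) p" by simp
    also have "\<dots> = ?S"
      unfolding mode_prod_def[of _ e] by (intro sum.cong refl) (simp only: IH lessThan_iff)
    finally show ?thesis .
  qed
  also have "\<dots> = (\<Sum>m\<in>M. \<Sum>k<dim_col (X e). w m * (v e m k * ?R m) * X e $$ (p ! e, k))"
    unfolding sum_distrib_right by (rule sum.swap)
  also have "\<dots> = (\<Sum>m\<in>M. w m * (?g m e * ?R m))"
    by (intro sum.cong refl) (simp add: sum_distrib_left sum_distrib_right mult_ac)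
  also have "\<dots> = (\<Sum>m\<in>M. w m * (\<Prod>j<d. ?g m j))"
    using e by (intro sum.cong refl arg_cong2[where f = "(*)"] prod.remove[symmetric]) auto
  finally show ?case .
qed

lemma mode_prods_sum_rank_one:
  assumes "\<And>p. length p = d \<Longrightarrow> (\<And>j. j < d \<Longrightarrow> p ! j < dim_col (X j)) \<Longrightarrow>
      A p = (\<Sum>m\<in>M. w m * (\<Prod>j<d. v j m (p ! j)))"
    and "length p = d"
  shows "mode_prods d A X p = (\<Sum>m\<in>M. w m * (\<Prod>j<d. \<Sum>k<dim_col (X j). X j $$ (p ! j, k) * v j m k))"
  using fold_mode_prod_sum_rank_one[where M = M and w = w and v = v and e = d, OF assms(1) order_refl assms(2)]
  unfolding mode_prods_def by simp

text \<open>A diagonal tensor is the combination of the rank-one tensors \<open>e\<^sub>m \<otimes> \<dots> \<otimes> e\<^sub>m\<close>. Letting \<open>m\<close> run up to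
  \<open>n 0\<close> covers the diagonal; a larger range of one mode only adds summands that vanish on
  \<open>tensor_index d n\<close>.\<close>

lemma diagonal_tensor_sum_rank_one:
  assumes D: "diagonal_tensor d n D" and d: "0 < d" and p: "p \<in> tensor_index d n"
  shows "D p = (\<Sum>m<n 0. D (replicate d m) * (\<Prod>j<d. if p ! j = m then 1 else 0))"
proof (cases "p = replicate d (p ! 0)")
  case True
  define a where "a = p ! 0"
  have p_eq: "p = replicate d a" using True by (simp add: a_def)
  have "a < n 0" using p d by (simp add: tensor_index_def a_def)
  have prod: "(\<Prod>j<d. if p ! j = m then 1 else 0) = (if m = a then 1 else (0 :: complex))" for m
    using d by (auto simp: p_eq)
  have "(\<Sum>m<n 0. D (replicate d m) * (\<Prod>j<d. if p ! j = m then 1 else 0))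
      = (\<Sum>m<n 0. if m = a then D (replicate d m) else 0)"
    unfolding prod by (intro sum.cong refl) simp
  then show ?thesis using \<open>a < n 0\<close> p_eq by simp
next
  case False
  then have "D p = 0"
    using D p d by (auto simp: diagonal_tensor_def)
  moreover have "(\<Prod>j<d. if p ! j = m then 1 else 0) = (0 :: complex)" for m
  proof -
    have "\<exists>j<d. p ! j \<noteq> m"
    proof (rule ccontr)
      assume "\<not> ?thesis"
      then have "p = replicate d m"
        using p by (intro nth_equalityI) (auto simp: tensor_index_def)
      with False d show False by auto
    qed
    then show ?thesis by (intro prod_zero) auto
  qed
  ultimately show ?thesis by simp
qed

text \<open>Two mode products in the same mode compose to a single one with the product of the matrices. The
  index \<open>m\<close> runs over the first mode and may exceed the size of mode \<open>j\<close>; then the vector \<open>e\<^sub>m\<close> is zero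
  in that mode.\<close>

lemma mode_prods_diagonal_tensor:
  assumes D: "diagonal_tensor d n D" and d: "0 < d"
    and A: "\<And>p. p \<in> tensor_index d n \<Longrightarrow> A p = mode_prods d D Y p"
    and Y: "\<And>j. j < d \<Longrightarrow> Y j \<in> carrier_mat (n j) (n j)"
    and X: "\<And>j. j < d \<Longrightarrow> X j \<in> carrier_mat (r' j) (n j)"
    and p: "length p = d" "\<And>j. j < d \<Longrightarrow> p ! j < r' j"
  shows "mode_prods d A X p = (\<Sum>m<n 0. D (replicate d m) *
    (\<Prod>j<d. if m < n j then (X j * Y j) $$ (p ! j, m) else 0))"
proof -
  let ?y = "\<lambda>j m q. if m < n j then Y j $$ (q, m) else 0"
  have A': "A q = (\<Sum>m<n 0. D (replicate d m) * (\<Prod>j<d. ?y j m (q ! j)))"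
    if q: "length q = d" "\<And>j. j < d \<Longrightarrow> q ! j < dim_col (X j)" for q
  proof -
    have "q \<in> tensor_index d n" using q carrier_matD(2)[OF X] by (auto simp: tensor_index_def)
    then have "A q = mode_prods d D Y q" by (rule A)
    also have "\<dots> = (\<Sum>m<n 0. D (replicate d m) *
        (\<Prod>j<d. \<Sum>k<dim_col (Y j). Y j $$ (q ! j, k) * (if k = m then 1 else 0)))"
    proof (rule mode_prods_sum_rank_one[OF _ q(1)])
      fix p assume "length p = d" "\<And>j. j < d \<Longrightarrow> p ! j < dim_col (Y j)"
      then have "p \<in> tensor_index d n" using carrier_matD(2)[OF Y] by (auto simp: tensor_index_def)
      then show "D p = (\<Sum>m<n 0. D (replicate d m) * (\<Prod>j<d. if p ! j = m then 1 else 0))"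
        by (rule diagonal_tensor_sum_rank_one[OF D d])
    qed
    also have "\<dots> = (\<Sum>m<n 0. D (replicate d m) * (\<Prod>j<d. ?y j m (q ! j)))"
    proof (intro sum.cong refl arg_cong2[where f = "(*)"] prod.cong)
      fix m j assume "j \<in> {..<d}"
      then show "(\<Sum>k<dim_col (Y j). Y j $$ (q ! j, k) * (if k = m then 1 else 0)) = ?y j m (q ! j)"
        using Y[of j] by (simp add: if_distrib sum.delta cong: if_cong)
    qed
    finally show ?thesis .
  qed
  have "mode_prods d A X p = (\<Sum>m<n 0. D (replicate d m) *
      (\<Prod>j<d. \<Sum>k<dim_col (X j). X j $$ (p ! j, k) * ?y j m k))"
  proof (rule mode_prods_sum_rank_one[OF _ p(1)])
    fix q assume "length q = d" "\<And>j. j < d \<Longrightarrow> q ! j < dim_col (X j)"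
    then show "A q = (\<Sum>m<n 0. D (replicate d m) * (\<Prod>j<d. ?y j m (q ! j)))" by (rule A')
  qed
  also have "\<dots> = (\<Sum>m<n 0. D (replicate d m) * (\<Prod>j<d. if m < n j then (X j * Y j) $$ (p ! j, m) else 0))"
  proof (intro sum.cong refl arg_cong2[where f = "(*)"] prod.cong)
    fix m j assume "j \<in> {..<d}"
    then have j: "j < d" by simp
    show "(\<Sum>k<dim_col (X j). X j $$ (p ! j, k) * ?y j m k) = (if m < n j then (X j * Y j) $$ (p ! j, m) else 0)"
      using index_mult_mat_sum[OF X[OF j] Y[OF j] p(2)[OF j], of m] X[OF j] by simp
  qed
  finally show ?thesis .
qed

section \<open>Restriction of the tensor function to one mode\<close>

text \<open>A mode \<open>j \<noteq> i\<close> contributes the factor \<open>1\<close> if \<open>m = p\<close> and \<open>0\<close> otherwise, so that a single summand of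
  the diagonal tensor survives.\<close>

lemma cmod_diagonal_entry_other_modes_fixed:
  fixes n :: "nat \<Rightarrow> nat"
  assumes D: "diagonal_tensor d n D" and d: "d > 1" and i: "i < d" and p: "p < r"
    and r: "\<And>j. j < d \<Longrightarrow> r \<le> n j"
    and dag: "dag = mat_adjoint \<or> dag = transpose_mat"
    and Q: "\<And>j. j < d \<Longrightarrow> unitary_mat (n j) (Q j)"
    and A: "\<And>q. q \<in> tensor_index d n \<Longrightarrow> A q = mode_prods d D (\<lambda>j. dag (mat_adjoint (Q j))) q"
    and U: "\<And>j. j < d \<Longrightarrow> U j \<in> carrier_mat (n j) r"
    and fixed: "\<And>j. j < d \<Longrightarrow> j \<noteq> i \<Longrightarrow> mat_adjoint (Q j) * U j = trunc_id (n j) r"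
  shows "cmod (mode_prods d A (\<lambda>j. dag (U j)) (replicate d p))
    = cmod (D (replicate d p)) * cmod ((mat_adjoint (Q i) * U i) $$ (p, p))"
proof -
  note Qc = unitary_matD(1,2)[OF Q]
  have dag_carrier: "dag B \<in> carrier_mat k m" if "B \<in> carrier_mat m k" for B m k
    using dag that by auto
  \<comment> \<open>The two readings of \<open>dag\<close> differ by a conjugation of the entries.\<close>
  define \<sigma> where "\<sigma> = (if dag = mat_adjoint then cnj else id)"
  have dag_mult: "(dag (U j) * dag (mat_adjoint (Q j))) $$ (p, m) = \<sigma> ((mat_adjoint (Q j) * U j) $$ (m, p))"
    if j: "j < d" and m: "m < n j" for j m
  proof (cases "dag = mat_adjoint")
    case True
    have "dag (U j) * dag (mat_adjoint (Q j)) = mat_adjoint (mat_adjoint (Q j) * U j)"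
      unfolding True by (rule mat_adjoint_mult[OF Qc(2)[OF j] U[OF j], symmetric])
    then show ?thesis
      using carrier_matD[OF Qc(1)[OF j]] carrier_matD[OF U[OF j]] p m True
      by (simp add: \<sigma>_def del: index_mult_mat(1))
  next
    case False
    then have T: "dag = transpose_mat" using dag by simp
    have "dag (U j) * dag (mat_adjoint (Q j)) = transpose_mat (mat_adjoint (Q j) * U j)"
      unfolding T by (rule transpose_mult[OF Qc(2)[OF j] U[OF j], symmetric])
    then show ?thesis
      using carrier_matD[OF Qc(1)[OF j]] carrier_matD[OF U[OF j]] p m False
      by (simp add: \<sigma>_def del: index_mult_mat(1))
  qed
  have \<sigma>_simps: "\<sigma> 0 = 0" "\<sigma> 1 = 1" "cmod (\<sigma> z) = cmod z" for z
    by (simp_all add: \<sigma>_def)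
  let ?F = "\<lambda>m j. if m < n j then (dag (U j) * dag (mat_adjoint (Q j))) $$ (p, m) else 0"
  have F_fixed: "?F m j = (if m = p then 1 else 0)" if "j < d" "j \<noteq> i" for m j
    using that p r[of j] by (auto simp: dag_mult fixed \<sigma>_simps trunc_id_def simp del: index_mult_mat(1))
  have F_i: "?F p i = \<sigma> ((mat_adjoint (Q i) * U i) $$ (p, p))"
    using dag_mult[OF i] p r[OF i] by simp
  obtain j0 where j0: "j0 < d" "j0 \<noteq> i"
    using d by (intro that[of "if i = 0 then 1 else 0"]) auto
  have prod: "(\<Prod>j<d. ?F m j) = (if m = p then \<sigma> ((mat_adjoint (Q i) * U i) $$ (p, p)) else 0)" for m
  proof (cases "m = p")
    case True
    have "(\<Prod>j<d. ?F p j) = ?F p i * (\<Prod>j\<in>{..<d} - {i}. ?F p j)"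
      using i by (intro prod.remove) auto
    also have "(\<Prod>j\<in>{..<d} - {i}. ?F p j) = 1"
      by (rule prod.neutral) (use F_fixed in auto)
    finally show ?thesis unfolding True F_i by (simp only: mult_1_right if_True simp_thms)
  next
    case False
    have "?F m j0 = 0" using F_fixed[OF j0, of m] False by simp
    then have "(\<Prod>j<d. ?F m j) = 0" using j0 by (intro prod_zero bexI[of _ j0]) auto
    then show ?thesis using False by simp
  qed
  have "mode_prods d A (\<lambda>j. dag (U j)) (replicate d p)
      = (\<Sum>m<n 0. D (replicate d m) * (\<Prod>j<d. if m < n j
          then (dag (U j) * dag (mat_adjoint (Q j))) $$ (replicate d p ! j, m) else 0))"
    by (rule mode_prods_diagonal_tensor[OF D _ A, where r' = "\<lambda>_. r"])
      (use d p U Qc in \<open>auto intro!: dag_carrier\<close>)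
  also have "\<dots> = (\<Sum>m<n 0. D (replicate d m) * (\<Prod>j<d. ?F m j))"
    by (intro sum.cong refl arg_cong2[where f = "(*)"] prod.cong) simp
  also have "\<dots> = (\<Sum>m<n 0. if m = p then D (replicate d p) * \<sigma> ((mat_adjoint (Q i) * U i) $$ (p, p)) else 0)"
    unfolding prod by (intro sum.cong refl) simp
  also have "\<dots> = D (replicate d p) * \<sigma> ((mat_adjoint (Q i) * U i) $$ (p, p))"
    using p r[of 0] d by (simp add: sum.delta del: index_mult_mat(1))
  finally show ?thesis by (simp add: norm_mult \<sigma>_simps del: index_mult_mat(1))
qed

lemma euclidean_norm_tensor_diag_power2:
  "(euclidean_norm (tensor_diag d r W))\<^sup>2 = (\<Sum>p<r. (cmod (W (replicate d p)))\<^sup>2)"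
  by (simp add: euclidean_norm_def tensor_diag_def sum_nonneg)

theorem proposition5p11:
  fixes d r L :: nat
    and n :: "nat \<Rightarrow> nat"
    and dag :: "complex mat \<Rightarrow> complex mat"
    and \<alpha> :: "nat \<Rightarrow> real"
    and D A :: "nat \<Rightarrow> ctensor"
    and Q :: "nat \<Rightarrow> complex mat"
    and f :: "(nat \<Rightarrow> complex mat) \<Rightarrow> real"
  assumes "d > 1"
    and "dag = mat_adjoint \<or> dag = transpose_mat"
    and "1 \<le> r" and "\<And>i. i < d \<Longrightarrow> r \<le> n i"
    and "\<And>l. l < L \<Longrightarrow> diagonal_tensor d n (D l)"
    and "\<And>l. l < L \<Longrightarrow> 0 \<le> \<alpha> l"
    and "\<And>i. i < d \<Longrightarrow> unitary_mat (n i) (Q i)"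
    and "\<And>l p. l < L \<Longrightarrow> p \<in> tensor_index d n \<Longrightarrow>
           A l p = mode_prods d (D l) (\<lambda>i. dag (mat_adjoint (Q i))) p"
    and "\<And>p. p < r \<Longrightarrow> (\<Sum>l<L. \<alpha> l * (cmod (D l (replicate d p)))\<^sup>2) \<noteq> 0"
    and "\<And>U. (\<And>i. i < d \<Longrightarrow> U i \<in> stiefel r (n i)) \<Longrightarrow>
           f U = (\<Sum>l<L. \<alpha> l *
             (euclidean_norm (tensor_diag d r (mode_prods d (A l) (\<lambda>i. dag (U i)))))\<^sup>2)"
  shows "scale_semi_nondegenerate_tuple d r n f (\<lambda>i. Q i * trunc_id (n i) r)"
  unfolding scale_semi_nondegenerate_tuple_def
proof (intro allI impI)
  fix i assume i: "i < d"
  let ?\<omega> = "\<lambda>i. Q i * trunc_id (n i) r"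
  define c where "c p = (\<Sum>l<L. \<alpha> l * (cmod (D l (replicate d p)))\<^sup>2)" for p
  interpret diagonal_overlap "n i" r "Q i" c "\<lambda>U. f (?\<omega>(i := U))"
  proof
    show "r \<le> n i" "unitary_mat (n i) (Q i)" by (fact assms(4)[OF i] assms(7)[OF i])+
    show "0 < c p" if "p < r" for p
      using assms(9)[OF that] assms(6) unfolding c_def
      by (auto intro!: sum_nonneg simp: less_le)
    fix X assume X: "X \<in> stiefel r (n i)"
    have st: "(?\<omega>(i := X)) j \<in> stiefel r (n j)" if "j < d" for j
      using X stiefel_unitary_mult_trunc_id[OF assms(7)[OF that] assms(4)[OF that]] by simp
    have entry: "cmod (mode_prods d (A l) (\<lambda>j. dag ((?\<omega>(i := X)) j)) (replicate d p))
        = cmod (D l (replicate d p)) * cmod ((mat_adjoint (Q i) * X) $$ (p, p))" if "l < L" "p < r" for l p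
      using cmod_diagonal_entry_other_modes_fixed[OF assms(5)[OF that(1)] assms(1) i that(2) assms(4) assms(2) assms(7)
          assms(8)[OF that(1)] stiefelD(1)[OF st]]
        unitary_matD(3)[OF assms(7) trunc_id_carrier] by simp
    have "f (?\<omega>(i := X)) = (\<Sum>l<L. \<alpha> l *
        (euclidean_norm (tensor_diag d r (mode_prods d (A l) (\<lambda>j. dag ((?\<omega>(i := X)) j)))))\<^sup>2)"
      by (rule assms(10)[OF st])
    also have "\<dots> = (\<Sum>l<L. \<Sum>p<r. \<alpha> l * (cmod (D l (replicate d p)))\<^sup>2 * (cmod ((mat_adjoint (Q i) * X) $$ (p, p)))\<^sup>2)"
      unfolding euclidean_norm_tensor_diag_power2 sum_distrib_left
      by (intro sum.cong refl) (simp only: entry lessThan_iff power_mult_distrib mult.assoc)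
    also have "\<dots> = (\<Sum>p<r. c p * (cmod ((mat_adjoint (Q i) * X) $$ (p, p)))\<^sup>2)"
      unfolding c_def sum_distrib_right by (rule sum.swap)
    finally show "f (?\<omega>(i := X)) = (\<Sum>p<r. c p * (cmod ((mat_adjoint (Q i) * X) $$ (p, p)))\<^sup>2)" .
  qed
  show "scale_semi_nondegenerate r (n i) (\<lambda>U. f (?\<omega>(i := U))) (?\<omega> i)"
    using scale_semi_nondegenerate_base unfolding base_def .
qed

end
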